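(* Let $\Sigma=(\Gamma,\sigma)$ be a signed graph with underlying graph $\Gamma=(V,E)$ and let $G$ be a finite additive abelian group. Write $r(\Gamma)=|V|-k(\Gamma)$. Then the number of nowhere-zero $G$-potential differences of $\Sigma$ is $$p_\Sigma(G)=(-1)^{r(\Gamma)}|2G|^{k_u(\Sigma)}\,T_\Sigma\Big(1-|G|,0,1-\frac{1}{|2G|}\Big),$$ and for $u\in G\setminus 2G$, $$p_\Sigma(G;u)=(-1)^{r(\Gamma)}|2G|^{k_u(\Sigma)}\,T_\Sigma(1-|G|,0,1).$$ In particular, if $\Sigma$ is connected and unbalanced, the number of nowhere-zero $G$-tensions of $\Sigma$ is $$t_\Sigma(G)=(-1)^{r(\Gamma)}|2G|\Big[T_\Sigma\Big(1-|G|,0,1-\frac{1}{|2G|}\Big)+\Big(\frac{|G|}{|2G|}-1\Big)T_\Sigma(1-|G|,0,1)\Big].$$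
   Context: A signed graph $\Sigma=(\Gamma,\sigma)$: finite graph $\Gamma=(V,E)$ (loops, multiple edges allowed), $\sigma:E\to\{-1,1\}$. A cycle (loops included) is balanced if the product of its edge signs is $1$, unbalanced otherwise; $\Sigma$ is balanced if all cycles are. For $A\subseteq E$, $\Sigma\backslash A^c$ is the spanning signed subgraph with edge set $A$. $k,k_b,k_u$: numbers of connected components, balanced components, unbalanced components. Signed Tutte polynomial: $$T_\Sigma(X,Y,Z)=\sum_{A\subseteq E}(X-1)^{k(\Sigma\backslash A^c)-k(\Sigma)}(Y-1)^{|A|-|V|+k_b(\Sigma\backslash A^c)}(Z-1)^{k_u(\Sigma\backslash A^c)}$$ (a polynomial; evaluating at $Z=1$ means evaluating this polynomial). Each edge $e$ with endpoints $u,v$ has half-edges $(u,e),(v,e)$ (a loop at $v$ has two half-edges at $v$); an orientation $\omega$ assigns $\pm1$ to each half-edge and is compatible with $\sigma$ if $\sigma(e)=-\omega(u,e)\omega(v,e)$ for each edge. Fix such $\omega$ (counts below do not depend on it). A walk $W=(v_1,e_1,v_2,\dots,v_k,e_k,v_{k+1})$ has $e_i$ joining $v_i,v_{i+1}$; $\omega(v_i,e_i)$ is the orientation of the half-edge of $e_i$ at $v_i$ by which the walk leaves $v_i$; $W$ is closed if $v_{k+1}=v_1$, positive if $\prod\sigma(e_i)=1$. Circuits of $\Sigma$: edge sets of balanced cycles; of unbalanced tight handcuffs (two unbalanced cycles sharing exactly one vertex); of unbalanced loose handcuffs (two vertex-disjoint unbalanced cycles joined by a path meeting them only at its endpoints;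 the path edges are circuit path edges). A circuit walk is a closed walk traversing a circuit, using circuit path edges twice and other edges once. A map $f:E\to G$ is a $G$-tension if for every circuit walk $W=(v_1,e_1,\dots,v_k,e_k,v_1)$, $\sum_{i=1}^k\big(\omega(v_i,e_i)\prod_{j=1}^{i-1}\sigma(e_j)\big)f(e_i)=0$. It is a $G$-potential difference if moreover for every closed walk $(v_1,e_1,\dots,e_k,v_1)$ around an unbalanced cycle, $\sum_{i}f(e_i)\in 2G$, where $2G=\{x+x:x\in G\}$. Nowhere-zero means $f(e)\ne0$ for all $e$. $t_\Sigma(G)$, $p_\Sigma(G)$ count nowhere-zero $G$-tensions and nowhere-zero $G$-potential differences; for $u\in G$, $p_\Sigma(G;u)$ is the number of nowhere-zero $G$-tensions $f$ such that for every closed walk $(v_1,e_1,\dots,e_k,v_1)$ around an unbalanced cycle, $\sum_i f(e_i)\in u+2G$. *)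

theory Defs
  imports Complex_Main "HOL-Library.FuncSet" "HOL-Library.Cardinality"
begin

text \<open>
  Every edge \<open>e\<close> has exactly two half-edges \<open>(e, False)\<close> and \<open>(e, True)\<close>, also when it is
  a loop; \<open>attach\<close> gives the vertex at which a half-edge sits.
\<close>

record ('v, 'e) signed_graph =
  verts :: "'v set"
  edges :: "'e set"
  attach :: "'e \<times> bool \<Rightarrow> 'v"
  esign :: "'e \<Rightarrow> int"

definition signed_graph :: "('v, 'e) signed_graph \<Rightarrow> bool" where
  "signed_graph \<Sigma> \<longleftrightarrow>
     finite (verts \<Sigma>) \<and> finite (edges \<Sigma>) \<and>
     (\<forall>e \<in> edges \<Sigma>. \<forall>b. attach \<Sigma> (e, b) \<in> verts \<Sigma>) \<and>
     (\<forall>e \<in> edges \<Sigma>. esign \<Sigma> e \<in> {-1, 1})"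

definition spanning_subgraph :: "('v, 'e) signed_graph \<Rightarrow> 'e set \<Rightarrow> ('v, 'e) signed_graph" where
  "spanning_subgraph \<Sigma> A = \<Sigma>\<lparr>edges := A\<rparr>"

definition induced_subgraph :: "('v, 'e) signed_graph \<Rightarrow> 'v set \<Rightarrow> ('v, 'e) signed_graph" where
  "induced_subgraph \<Sigma> U =
     \<Sigma>\<lparr>verts := U, edges := {e \<in> edges \<Sigma>. \<forall>b. attach \<Sigma> (e, b) \<in> U}\<rparr>"


subsection \<open>Walks, cycles and components\<close>

text \<open>
  A walk is given by its start vertex and the list of half-edges by which it leaves
  its successive vertices: leaving by \<open>(e, b)\<close>, it traverses \<open>e\<close> and arrives at
  the vertex of the other half-edge \<open>(e, \<not> b)\<close>.
\<close>

definition tail :: "('v, 'e) signed_graph \<Rightarrow> 'e \<times> bool \<Rightarrow> 'v" where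
  "tail \<Sigma> h = attach \<Sigma> h"

definition head :: "('v, 'e) signed_graph \<Rightarrow> 'e \<times> bool \<Rightarrow> 'v" where
  "head \<Sigma> h = attach \<Sigma> (fst h, \<not> snd h)"

fun walk :: "('v, 'e) signed_graph \<Rightarrow> 'v \<Rightarrow> ('e \<times> bool) list \<Rightarrow> 'v \<Rightarrow> bool" where
  "walk \<Sigma> u [] v \<longleftrightarrow> u \<in> verts \<Sigma> \<and> u = v"
| "walk \<Sigma> u (h # W) v \<longleftrightarrow> fst h \<in> edges \<Sigma> \<and> tail \<Sigma> h = u \<and> walk \<Sigma> (head \<Sigma> h) W v"

definition closed_walk :: "('v, 'e) signed_graph \<Rightarrow> ('e \<times> bool) list \<Rightarrow> bool" where
  "closed_walk \<Sigma> W \<longleftrightarrow> (\<exists>v. walk \<Sigma> v W v)"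

definition edge_list :: "('e \<times> bool) list \<Rightarrow> 'e list" where
  "edge_list W = map fst W"

definition end_verts :: "('v, 'e) signed_graph \<Rightarrow> 'e set \<Rightarrow> 'v set" where
  "end_verts \<Sigma> C = attach \<Sigma> ` (C \<times> UNIV)"

text \<open>
  Cycles are identified with their edge sets. A loop is a cycle of length 1 and two parallel
  edges form a cycle of length 2.
\<close>

definition cycle :: "('v, 'e) signed_graph \<Rightarrow> 'e set \<Rightarrow> bool" where
  "cycle \<Sigma> C \<longleftrightarrow>
     (\<exists>W. closed_walk \<Sigma> W \<and> W \<noteq> [] \<and> distinct (map (tail \<Sigma>) W) \<and>
          distinct (edge_list W) \<and> set (edge_list W) = C)"

definition balanced_cycle :: "('v, 'e) signed_graph \<Rightarrow> 'e set \<Rightarrow> bool" where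
  "balanced_cycle \<Sigma> C \<longleftrightarrow> cycle \<Sigma> C \<and> (\<Prod>e\<in>C. esign \<Sigma> e) = 1"

definition unbalanced_cycle :: "('v, 'e) signed_graph \<Rightarrow> 'e set \<Rightarrow> bool" where
  "unbalanced_cycle \<Sigma> C \<longleftrightarrow> cycle \<Sigma> C \<and> (\<Prod>e\<in>C. esign \<Sigma> e) \<noteq> 1"

definition balanced :: "('v, 'e) signed_graph \<Rightarrow> bool" where
  "balanced \<Sigma> \<longleftrightarrow> (\<forall>C. cycle \<Sigma> C \<longrightarrow> balanced_cycle \<Sigma> C)"

definition components :: "('v, 'e) signed_graph \<Rightarrow> 'v set set" where
  "components \<Sigma> = verts \<Sigma> // {(u, v). \<exists>W. walk \<Sigma> u W v}"

definition num_comps :: "('v, 'e) signed_graph \<Rightarrow> nat" where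
  "num_comps \<Sigma> = card (components \<Sigma>)"

definition num_bal_comps :: "('v, 'e) signed_graph \<Rightarrow> nat" where
  "num_bal_comps \<Sigma> = card {U \<in> components \<Sigma>. balanced (induced_subgraph \<Sigma> U)}"

definition num_unbal_comps :: "('v, 'e) signed_graph \<Rightarrow> nat" where
  "num_unbal_comps \<Sigma> = card {U \<in> components \<Sigma>. \<not> balanced (induced_subgraph \<Sigma> U)}"

definition connected_graph :: "('v, 'e) signed_graph \<Rightarrow> bool" where
  "connected_graph \<Sigma> \<longleftrightarrow> num_comps \<Sigma> = 1"

definition graph_rank :: "('v, 'e) signed_graph \<Rightarrow> nat" where
  "graph_rank \<Sigma> = card (verts \<Sigma>) - num_comps \<Sigma>"

text \<open>
  Integer exponents avoid truncated subtraction. All exponents are in fact nonnegative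
  and \<open>0 powi 0 = 1\<close>, so this is evaluation of the polynomial at every point,
  including \<open>Z = 1\<close>.
\<close>

definition signed_tutte :: "('v, 'e) signed_graph \<Rightarrow> real \<Rightarrow> real \<Rightarrow> real \<Rightarrow> real" where
  "signed_tutte \<Sigma> X Y Z =
     (\<Sum>A \<in> Pow (edges \<Sigma>).
        (X - 1) powi (int (num_comps (spanning_subgraph \<Sigma> A)) - int (num_comps \<Sigma>)) *
        (Y - 1) powi (int (card A) - int (card (verts \<Sigma>))
                      + int (num_bal_comps (spanning_subgraph \<Sigma> A))) *
        (Z - 1) ^ num_unbal_comps (spanning_subgraph \<Sigma> A))"


subsection \<open>Circuits\<close>

definition path_between ::
    "('v, 'e) signed_graph \<Rightarrow> 'v \<Rightarrow> ('e \<times> bool) list \<Rightarrow> 'v \<Rightarrow> bool" where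
  "path_between \<Sigma> u W v \<longleftrightarrow> walk \<Sigma> u W v \<and> distinct (u # map (head \<Sigma>) W)"

text \<open>
  \<open>circuit \<Sigma> C P\<close>: \<open>C\<close> is the edge set of a circuit whose set of circuit path edges is \<open>P\<close>.
  For tight handcuffs \<open>C\<^sub>1 \<noteq> C\<^sub>2\<close> is needed, as a loop shares exactly one vertex with itself.
\<close>

inductive circuit :: "('v, 'e) signed_graph \<Rightarrow> 'e set \<Rightarrow> 'e set \<Rightarrow> bool" for \<Sigma> where
  balanced_cycle: "balanced_cycle \<Sigma> C \<Longrightarrow> circuit \<Sigma> C {}"
| tight_handcuff:
    "\<lbrakk>unbalanced_cycle \<Sigma> C\<^sub>1; unbalanced_cycle \<Sigma> C\<^sub>2; C\<^sub>1 \<noteq> C\<^sub>2;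
      end_verts \<Sigma> C\<^sub>1 \<inter> end_verts \<Sigma> C\<^sub>2 = {v}\<rbrakk>
     \<Longrightarrow> circuit \<Sigma> (C\<^sub>1 \<union> C\<^sub>2) {}"
| loose_handcuff:
    "\<lbrakk>unbalanced_cycle \<Sigma> C\<^sub>1; unbalanced_cycle \<Sigma> C\<^sub>2;
      end_verts \<Sigma> C\<^sub>1 \<inter> end_verts \<Sigma> C\<^sub>2 = {};
      path_between \<Sigma> u W v; P = set (edge_list W);
      end_verts \<Sigma> P \<inter> end_verts \<Sigma> C\<^sub>1 = {u};
      end_verts \<Sigma> P \<inter> end_verts \<Sigma> C\<^sub>2 = {v}\<rbrakk>
     \<Longrightarrow> circuit \<Sigma> (C\<^sub>1 \<union> P \<union> C\<^sub>2) P"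

definition circuit_walk :: "('v, 'e) signed_graph \<Rightarrow> ('e \<times> bool) list \<Rightarrow> bool" where
  "circuit_walk \<Sigma> W \<longleftrightarrow>
     (\<exists>C P. circuit \<Sigma> C P \<and> closed_walk \<Sigma> W \<and> set (edge_list W) = C \<and>
        (\<forall>e \<in> C. count_list (edge_list W) e = (if e \<in> P then 2 else 1)))"

definition unbalanced_cycle_walk :: "('v, 'e) signed_graph \<Rightarrow> ('e \<times> bool) list \<Rightarrow> bool" where
  "unbalanced_cycle_walk \<Sigma> W \<longleftrightarrow>
     closed_walk \<Sigma> W \<and> distinct (edge_list W) \<and> unbalanced_cycle \<Sigma> (set (edge_list W))"


subsection \<open>Tensions and potential differences\<close>

definition compatible_orientation ::
    "('v, 'e) signed_graph \<Rightarrow> ('e \<times> bool \<Rightarrow> int) \<Rightarrow> bool" where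
  "compatible_orientation \<Sigma> \<omega> \<longleftrightarrow>
     (\<forall>e \<in> edges \<Sigma>. (\<forall>b. \<omega> (e, b) \<in> {-1, 1}) \<and>
        esign \<Sigma> e = - \<omega> (e, False) * \<omega> (e, True))"

text \<open>The action of a sign \<open>s \<in> {-1, 1}\<close> on an abelian group.\<close>

definition sign_scale :: "int \<Rightarrow> 'g::ab_group_add \<Rightarrow> 'g" where
  "sign_scale s x = (if s = 1 then x else - x)"

definition doubles :: "'g::ab_group_add set" where
  "doubles = range (\<lambda>x. x + x)"

definition tension ::
    "('v, 'e) signed_graph \<Rightarrow> ('e \<times> bool \<Rightarrow> int) \<Rightarrow> ('e \<Rightarrow> 'g::ab_group_add) \<Rightarrow> bool" where
  "tension \<Sigma> \<omega> f \<longleftrightarrow>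
     (\<forall>W. circuit_walk \<Sigma> W \<longrightarrow>
        (\<Sum>i<length W.
           sign_scale (\<omega> (W ! i) * (\<Prod>j<i. esign \<Sigma> (edge_list W ! j))) (f (edge_list W ! i))) = 0)"

definition potential_difference ::
    "('v, 'e) signed_graph \<Rightarrow> ('e \<times> bool \<Rightarrow> int) \<Rightarrow> ('e \<Rightarrow> 'g::ab_group_add) \<Rightarrow> bool" where
  "potential_difference \<Sigma> \<omega> f \<longleftrightarrow>
     tension \<Sigma> \<omega> f \<and>
     (\<forall>W. unbalanced_cycle_walk \<Sigma> W \<longrightarrow> (\<Sum>e\<leftarrow>edge_list W. f e) \<in> doubles)"

definition nowhere_zero :: "('v, 'e) signed_graph \<Rightarrow> ('e \<Rightarrow> 'g::ab_group_add) \<Rightarrow> bool" where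
  "nowhere_zero \<Sigma> f \<longleftrightarrow> (\<forall>e \<in> edges \<Sigma>. f e \<noteq> 0)"

definition nz_tensions ::
    "('v, 'e) signed_graph \<Rightarrow> ('e \<times> bool \<Rightarrow> int) \<Rightarrow> ('e \<Rightarrow> 'g::ab_group_add) set" where
  "nz_tensions \<Sigma> \<omega> =
     {f \<in> edges \<Sigma> \<rightarrow>\<^sub>E UNIV. tension \<Sigma> \<omega> f \<and> nowhere_zero \<Sigma> f}"

definition nz_potential_differences ::
    "('v, 'e) signed_graph \<Rightarrow> ('e \<times> bool \<Rightarrow> int) \<Rightarrow> ('e \<Rightarrow> 'g::ab_group_add) set" where
  "nz_potential_differences \<Sigma> \<omega> =
     {f \<in> edges \<Sigma> \<rightarrow>\<^sub>E UNIV. potential_difference \<Sigma> \<omega> f \<and> nowhere_zero \<Sigma> f}"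

definition nz_tensions_coset ::
    "('v, 'e) signed_graph \<Rightarrow> ('e \<times> bool \<Rightarrow> int) \<Rightarrow> 'g::ab_group_add \<Rightarrow> ('e \<Rightarrow> 'g) set" where
  "nz_tensions_coset \<Sigma> \<omega> u =
     {f \<in> nz_tensions \<Sigma> \<omega>.
        \<forall>W. unbalanced_cycle_walk \<Sigma> W \<longrightarrow> (\<Sum>e\<leftarrow>edge_list W. f e) \<in> (+) u ` doubles}"

end

theory Submission
  imports Defs
begin

text \<open>
  Write \<open>S(W)\<close> for the signed sum of \<open>f\<close> along a walk \<open>W\<close>. A tension has \<open>S(W) = 0\<close> for every
  positive closed walk \<open>W\<close>, not only for circuit walks: in a shortest counterexample, rotate so that
  \<open>W\<close> starts with an unbalanced cycle \<open>C\<^sub>0\<close> and let \<open>Q C R\<close> be the first-return decomposition of the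
  rest; by minimality \<open>S(W) = S(C\<^sub>0 Q C Q\<^sup>-\<^sup>1)\<close>, and the latter is a handcuff.

  Consequently, for every \<open>u\<close>, the tensions whose sums around unbalanced cycles lie in \<open>u + 2G\<close> are
  exactly the maps \<open>\<delta>\<^sub>u p\<close> with \<open>p : V \<rightarrow> G\<close>, where \<open>\<delta>\<^sub>u p\<close> is the coboundary of \<open>p + w\<close> for
  a formal \<open>w\<close> with \<open>2w = u\<close>. On an edge set \<open>A\<close> the equation \<open>\<delta>\<^sub>u p = 0\<close> leaves \<open>|G|\<close> choices for
  every balanced component and the solutions of \<open>2x = -u\<close> for every unbalanced one. Inclusion-exclusion
  over \<open>A\<close> gives the Tutte polynomial, and the fibres of \<open>\<delta>\<^sub>u\<close> are counted by the case \<open>A = E\<close>,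
  \<open>u = 0\<close>. If the graph is connected and unbalanced, every tension belongs to a unique coset of \<open>2G\<close>.
\<close>

section \<open>Walks\<close>

lemma sign_scale_simps [simp]:
  "sign_scale 1 x = x" "sign_scale (-1) x = - x" "sign_scale s 0 = 0"
  by (auto simp: sign_scale_def)

lemma sign_scale_add: "sign_scale s (x + y) = sign_scale s x + sign_scale s y"
  by (auto simp: sign_scale_def)

definition rev_walk :: "('e \<times> bool) list \<Rightarrow> ('e \<times> bool) list" where
  "rev_walk W = rev (map (\<lambda>(e, b). (e, \<not> b)) W)"

definition walk_sign :: "('v, 'e) signed_graph \<Rightarrow> ('e \<times> bool) list \<Rightarrow> int" where
  "walk_sign \<Sigma> W = (\<Prod>h\<leftarrow>W. esign \<Sigma> (fst h))"

text \<open>The recursion pulls the sign of the first edge out of the remaining sum, which makes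
  concatenation and reversal provable by induction. \<open>walk_sum_eq_sum\<close> identifies it
  with the formula in \<open>tension\<close>.\<close>

fun walk_sum ::
    "('v, 'e) signed_graph \<Rightarrow> ('e \<times> bool \<Rightarrow> int) \<Rightarrow> ('e \<Rightarrow> 'g::ab_group_add) \<Rightarrow>
     ('e \<times> bool) list \<Rightarrow> 'g" where
  "walk_sum \<Sigma> \<omega> f [] = 0"
| "walk_sum \<Sigma> \<omega> f (h # W) =
     sign_scale (\<omega> h) (f (fst h)) + sign_scale (esign \<Sigma> (fst h)) (walk_sum \<Sigma> \<omega> f W)"

lemma walk_sign_simps [simp]:
  "walk_sign \<Sigma> [] = 1"
  "walk_sign \<Sigma> (h # W) = esign \<Sigma> (fst h) * walk_sign \<Sigma> W"
  "walk_sign \<Sigma> (V @ W) = walk_sign \<Sigma> V * walk_sign \<Sigma> W"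
  by (auto simp: walk_sign_def)

lemma rev_walk_simps [simp]:
  "rev_walk [] = []"
  "rev_walk (h # W) = rev_walk W @ [(fst h, \<not> snd h)]"
  "length (rev_walk W) = length W"
  "walk_sign \<Sigma> (rev_walk W) = walk_sign \<Sigma> W"
  "map fst (rev_walk W) = rev (map fst W)"
proof -
  show "walk_sign \<Sigma> (rev_walk W) = walk_sign \<Sigma> W"
    by (induction W) (auto simp: rev_walk_def)
qed (auto simp: rev_walk_def rev_map case_prod_unfold o_def)

lemma tail_head_reverse [simp]:
  "tail \<Sigma> (fst h, \<not> snd h) = head \<Sigma> h" "head \<Sigma> (fst h, \<not> snd h) = tail \<Sigma> h"
  by (auto simp: tail_def head_def)

lemma walk_sign_eq_prod:
  assumes "distinct (edge_list W)"
  shows "walk_sign \<Sigma> W = (\<Prod>e\<in>set (edge_list W). esign \<Sigma> e)"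
  using assms by (induction W) (auto simp: edge_list_def)

text \<open>Expresses the sign of a walk through the multiplicities of its edges, the only data that
  \<open>circuit_walk\<close> prescribes.\<close>

lemma prod_list_count_list:
  fixes g :: "'a \<Rightarrow> 'b::comm_monoid_mult"
  assumes "finite A" "set xs \<subseteq> A"
  shows "prod_list (map g xs) = (\<Prod>x\<in>A. g x ^ count_list xs x)"
  using assms(2)
proof (induction xs)
  case (Cons a xs)
  have "(\<Prod>x\<in>A. g x ^ count_list (a # xs) x) =
        (\<Prod>x\<in>A. (if x = a then g x else 1) * g x ^ count_list xs x)"
    by (intro prod.cong) auto
  also have "\<dots> = g a * (\<Prod>x\<in>A. g x ^ count_list xs x)"
    using Cons.prems assms(1) by (simp add: prod.distrib)
  finally show ?case
    using Cons by simp
qed simp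

section \<open>Walks in a finite signed graph\<close>

locale finite_signed_graph =
  fixes \<Sigma> :: "('v, 'e) signed_graph"
  assumes signed_graph: "signed_graph \<Sigma>"
begin

lemma finite_verts: "finite (verts \<Sigma>)" and finite_edges: "finite (edges \<Sigma>)"
  using signed_graph by (auto simp: signed_graph_def)

lemma attach_verts: "e \<in> edges \<Sigma> \<Longrightarrow> attach \<Sigma> (e, b) \<in> verts \<Sigma>"
  using signed_graph by (auto simp: signed_graph_def)

lemma esign_cases: "e \<in> edges \<Sigma> \<Longrightarrow> esign \<Sigma> e = 1 \<or> esign \<Sigma> e = -1"
  using signed_graph by (auto simp: signed_graph_def)

lemma tail_verts: "fst h \<in> edges \<Sigma> \<Longrightarrow> tail \<Sigma> h \<in> verts \<Sigma>"
  and head_verts: "fst h \<in> edges \<Sigma> \<Longrightarrow> head \<Sigma> h \<in> verts \<Sigma>"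
  using attach_verts[of "fst h" "snd h"] attach_verts[of "fst h" "\<not> snd h"]
  by (auto simp: tail_def head_def)

lemma walk_verts: "walk \<Sigma> a W b \<Longrightarrow> a \<in> verts \<Sigma>" "walk \<Sigma> a W b \<Longrightarrow> b \<in> verts \<Sigma>"
  by (induction W arbitrary: a) (auto simp: tail_verts)

lemma walk_append [simp]:
  "walk \<Sigma> a (V @ W) b \<longleftrightarrow> (\<exists>c. walk \<Sigma> a V c \<and> walk \<Sigma> c W b)"
  by (induction V arbitrary: a) (auto dest: walk_verts)

lemma walk_rev: "walk \<Sigma> a W b \<Longrightarrow> walk \<Sigma> b (rev_walk W) a"
  by (induction W arbitrary: a) (auto simp: tail_verts)

lemma walk_edges: "walk \<Sigma> a W b \<Longrightarrow> h \<in> set W \<Longrightarrow> fst h \<in> edges \<Sigma>"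
  by (induction W arbitrary: a) auto

lemma walk_sign_cases: "walk \<Sigma> a W b \<Longrightarrow> walk_sign \<Sigma> W = 1 \<or> walk_sign \<Sigma> W = -1"
proof (induction W arbitrary: a)
  case (Cons h W)
  then have "walk_sign \<Sigma> W = 1 \<or> walk_sign \<Sigma> W = -1" "esign \<Sigma> (fst h) = 1 \<or> esign \<Sigma> (fst h) = -1"
    using esign_cases by auto
  then show ?case
    by auto
qed simp

text \<open>Both sides list the visited vertices in order, so distinctness and membership can be
  moved between tails and heads.\<close>

lemma walk_tails_heads: "walk \<Sigma> a W b \<Longrightarrow> a # map (head \<Sigma>) W = map (tail \<Sigma>) W @ [b]"
  by (induction W arbitrary: a) auto

lemma walk_split_at_tail:
  assumes "walk \<Sigma> a W b" "x \<in> set (map (tail \<Sigma>) W)"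
  obtains U V where "W = U @ V" "walk \<Sigma> a U x" "walk \<Sigma> x V b"
proof -
  obtain h where "h \<in> set W" "tail \<Sigma> h = x"
    using assms(2) by auto
  then obtain U V where "W = U @ h # V"
    by (meson split_list)
  with assms(1) that[of U "h # V"] \<open>tail \<Sigma> h = x\<close> show thesis
    by auto
qed

text \<open>Handcuffs are defined by the vertex sets of their parts; this translates these sets into
  tails of walks.\<close>

lemma end_verts_walk:
  assumes "walk \<Sigma> a W b" "W \<noteq> []"
  shows "end_verts \<Sigma> (set (edge_list W)) = insert b (set (map (tail \<Sigma>) W))"
proof -
  have "end_verts \<Sigma> (set (edge_list W)) = set (map (tail \<Sigma>) W) \<union> set (map (head \<Sigma>) W)"
  proof -
    have "attach \<Sigma> (fst h, c) \<in> {tail \<Sigma> h, head \<Sigma> h}" for h c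
      by (cases h; cases "c = snd h") (auto simp: tail_def head_def)
    then have "end_verts \<Sigma> (set (edge_list W)) \<subseteq> set (map (tail \<Sigma>) W) \<union> set (map (head \<Sigma>) W)"
      by (fastforce simp: end_verts_def edge_list_def)
    moreover have *: "attach \<Sigma> (fst h, c) \<in> end_verts \<Sigma> (set (edge_list W))" if "h \<in> set W" for h c
      using that by (auto simp: end_verts_def edge_list_def)
    have "tail \<Sigma> h \<in> end_verts \<Sigma> (set (edge_list W))"
      "head \<Sigma> h \<in> end_verts \<Sigma> (set (edge_list W))" if "h \<in> set W" for h
      using that *[of h "snd h"] *[of h "\<not> snd h"] by (simp_all add: tail_def head_def)
    ultimately show ?thesis
      by auto
  qed
  moreover have "insert a (set (map (head \<Sigma>) W)) = insert b (set (map (tail \<Sigma>) W))"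
    using arg_cong[OF walk_tails_heads[OF assms(1)], of set] by simp
  moreover have "a \<in> set (map (tail \<Sigma>) W)"
    using assms by (cases W) auto
  moreover have "b = last (a # map (head \<Sigma>) W)"
    by (simp only: walk_tails_heads[OF assms(1)] last_snoc)
  then have "b \<in> set (map (head \<Sigma>) W)"
    using assms(2) by (simp del: set_map)
  ultimately show ?thesis
    by auto
qed

lemma end_verts_closed_walk:
  assumes "walk \<Sigma> a W a" "W \<noteq> []"
  shows "end_verts \<Sigma> (set (edge_list W)) = set (map (tail \<Sigma>) W)"
  using end_verts_walk[OF assms] assms by (cases W) auto

section \<open>Cycles and first returns\<close>

text \<open>Stop at the first tail that occurred before and cut the prefix at the earlier
  occurrence; its tails are still distinct. If no tail repeats, \<open>C\<close> is the whole
  walk.\<close>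

lemma first_return:
  assumes "walk \<Sigma> v W v" "W \<noteq> []"
  obtains Q C R w where "W = Q @ C @ R" "walk \<Sigma> v Q w" "walk \<Sigma> w C w" "walk \<Sigma> w R v"
    "C \<noteq> []" "distinct (map (tail \<Sigma>) (Q @ C))"
proof (cases "distinct (map (tail \<Sigma>) W)")
  case True
  with assms that[of "[]" W "[]" v] show thesis
    using walk_verts by auto
next
  case False
  then obtain xs y ys where *: "y \<in> set xs" "distinct xs" "map (tail \<Sigma>) W = xs @ y # ys"
    by (auto simp: not_distinct_conv_prefix)
  then obtain P h R where W: "W = P @ h # R" "xs = map (tail \<Sigma>) P" "y = tail \<Sigma> h"
    by (auto simp: map_eq_append_conv map_eq_Cons_conv)
  then have P: "walk \<Sigma> v P y" and R: "walk \<Sigma> y (h # R) v"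
    using assms(1) by auto
  obtain Q C where QC: "P = Q @ C" "walk \<Sigma> v Q y" "walk \<Sigma> y C y" "C \<noteq> []"
  proof -
    obtain g where "g \<in> set P" "tail \<Sigma> g = y"
      using * W by auto
    then obtain Q C where "P = Q @ g # C"
      by (meson split_list)
    with P that[of Q "g # C"] \<open>tail \<Sigma> g = y\<close> show thesis
      by auto
  qed
  show thesis
    using that[of Q C "h # R" y] W QC R * by auto
qed

lemma closed_walk_head_nth:
  assumes "walk \<Sigma> v W v" "i < length W"
  shows "head \<Sigma> (W ! i) = tail \<Sigma> (W ! (if Suc i = length W then 0 else Suc i))"
proof -
  have "head \<Sigma> (W ! i) = (v # map (head \<Sigma>) W) ! Suc i"
    using assms by simp
  also have "\<dots> = (map (tail \<Sigma>) W @ [v]) ! Suc i"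
    using walk_tails_heads[OF assms(1)] by simp
  also have "\<dots> = tail \<Sigma> (W ! (if Suc i = length W then 0 else Suc i))"
    using assms by (cases W) (auto simp: nth_append)
  finally show ?thesis .
qed

text \<open>A repeated half-edge would repeat a tail, so the edge is used in both directions. Then
  each of the two positions is the cyclic successor of the other.\<close>

lemma closed_walk_distinct_edges:
  assumes "walk \<Sigma> v W v" "distinct (map (tail \<Sigma>) W)" "\<not> distinct (edge_list W)"
  obtains e b where "W = [(e, b), (e, \<not> b)]"
proof -
  let ?s = "\<lambda>i. if Suc i = length W then 0 else Suc i"
  obtain i j where ij: "i < j" "j < length W" "fst (W ! i) = fst (W ! j)"
    using assms(3) by (auto simp: edge_list_def distinct_conv_nth) (metis linorder_neqE_nat)
  have inj: "k = l" if "tail \<Sigma> (W ! k) = tail \<Sigma> (W ! l)" "k < length W" "l < length W" for k l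
    using that assms(2) by (auto simp: distinct_conv_nth)
  have "W ! i \<noteq> W ! j"
    using ij inj[of i j] by auto
  then have snd: "snd (W ! j) \<longleftrightarrow> \<not> snd (W ! i)"
    using ij by (auto simp: prod_eq_iff)
  then have "W ! j = (fst (W ! i), \<not> snd (W ! i))"
    using ij(3) by (simp add: prod_eq_iff)
  then have "head \<Sigma> (W ! i) = tail \<Sigma> (W ! j)" "head \<Sigma> (W ! j) = tail \<Sigma> (W ! i)"
    by simp_all
  then have "tail \<Sigma> (W ! ?s i) = tail \<Sigma> (W ! j)" "tail \<Sigma> (W ! ?s j) = tail \<Sigma> (W ! i)"
    using closed_walk_head_nth[OF assms(1), of i] closed_walk_head_nth[OF assms(1), of j] ij
    by simp_all
  moreover have "?s i < length W" "?s j < length W"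
    using ij by auto
  ultimately have "?s i = j" "?s j = i"
    using ij inj[of "?s i" j] inj[of "?s j" i] by (simp_all del: if_split)
  \<comment> \<open>Two positions that are cyclic successors of each other fill the whole
    walk.\<close>
  with ij have "i = 0" "j = 1" "length W = 2"
    by (auto split: if_splits)
  then obtain g h where "W = [g, h]"
    by (auto simp: length_Suc_conv numeral_2_eq_2)
  with snd ij \<open>i = 0\<close> \<open>j = 1\<close> have "W = [(fst g, snd g), (fst g, \<not> snd g)]"
    by (cases g; cases h) auto
  then show thesis
    using that by blast
qed

text \<open>The vertex after a loop is its own tail; as tails are distinct, the position is its own
  cyclic successor.\<close>

lemma closed_walk_loop:
  assumes "walk \<Sigma> v W v" "distinct (map (tail \<Sigma>) W)" "h \<in> set W" "head \<Sigma> h = tail \<Sigma> h"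
  shows "W = [h]"
proof -
  obtain i where i: "i < length W" "W ! i = h"
    using assms(3) by (auto simp: in_set_conv_nth)
  define s where "s = (if Suc i = length W then 0 else Suc i)"
  have "tail \<Sigma> (W ! s) = tail \<Sigma> (W ! i)" "s < length W"
    using closed_walk_head_nth[OF assms(1) i(1)] i assms(4) by (auto simp: s_def)
  then have "map (tail \<Sigma>) W ! s = map (tail \<Sigma>) W ! i"
    using i(1) by simp
  then have "s = i"
    using nth_eq_iff_index_eq[OF assms(2)] i(1) \<open>s < length W\<close> by simp
  then have "length W = 1" "i = 0"
    using i(1) by (simp_all add: s_def split: if_splits)
  then show ?thesis
    using i(2) by (cases W) auto
qed

lemma cycleI:
  assumes "walk \<Sigma> v W v" "distinct (map (tail \<Sigma>) W)" "distinct (edge_list W)" "W \<noteq> []"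
  shows "cycle \<Sigma> (set (edge_list W))"
  using assms by (auto simp: cycle_def closed_walk_def)

text \<open>Going along an edge and back has positive sign, so a negative closed walk with distinct
  tails cannot be degenerate and runs around a genuine cycle.\<close>

lemma negative_cycle:
  assumes "walk \<Sigma> v W v" "distinct (map (tail \<Sigma>) W)" "walk_sign \<Sigma> W = -1"
  shows "distinct (edge_list W)" "unbalanced_cycle \<Sigma> (set (edge_list W))"
proof -
  show d: "distinct (edge_list W)"
  proof (rule ccontr)
    assume "\<not> distinct (edge_list W)"
    then obtain e b where W: "W = [(e, b), (e, \<not> b)]"
      using closed_walk_distinct_edges assms by blast
    then have "e \<in> edges \<Sigma>"
      using assms(1) by auto
    with W assms(3) esign_cases[of e] show False
      by auto
  qed
  show "unbalanced_cycle \<Sigma> (set (edge_list W))"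
    using cycleI[OF assms(1,2) d] assms(3) d walk_sign_eq_prod[OF d, of \<Sigma>]
    by (cases W) (auto simp: unbalanced_cycle_def)
qed

section \<open>Circuits and handcuffs\<close>

lemma cycle_loop:
  assumes "cycle \<Sigma> C" "e \<in> C" "attach \<Sigma> (e, False) = attach \<Sigma> (e, True)"
  shows "C = {e}"
proof -
  obtain v W where W: "walk \<Sigma> v W v" "distinct (map (tail \<Sigma>) W)" "set (edge_list W) = C"
    using assms(1) by (auto simp: cycle_def closed_walk_def)
  then obtain b where "(e, b) \<in> set W"
    using assms(2) by (auto simp: edge_list_def)
  moreover have "head \<Sigma> (e, b) = tail \<Sigma> (e, b)"
    using assms(3) by (cases b) (auto simp: head_def tail_def)
  ultimately have "W = [(e, b)]"
    using closed_walk_loop[OF W(1,2)] by blast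
  with W(3) show ?thesis
    by (simp add: edge_list_def)
qed

lemma unbalanced_cycle_prod: "unbalanced_cycle \<Sigma> C \<Longrightarrow> (\<Prod>e\<in>C. esign \<Sigma> e) = -1"
proof -
  assume C: "unbalanced_cycle \<Sigma> C"
  then obtain v W where W: "walk \<Sigma> v W v" "distinct (edge_list W)" "set (edge_list W) = C"
    by (auto simp: unbalanced_cycle_def cycle_def closed_walk_def)
  show ?thesis
    using walk_sign_cases[OF W(1)] walk_sign_eq_prod[OF W(2), of \<Sigma>] W(3) C
    by (simp add: unbalanced_cycle_def)
qed

text \<open>Keeps the circuit path edges out of the two cycles of a loose handcuff, since the path
  meets each cycle in a single vertex.\<close>

lemma path_between_no_loop:
  assumes "path_between \<Sigma> a W b" "h \<in> set W"
  shows "head \<Sigma> h \<noteq> tail \<Sigma> h"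
proof -
  obtain U V where "W = U @ h # V"
    using assms(2) by (meson split_list)
  then have "walk \<Sigma> a U (tail \<Sigma> h)" "distinct (a # map (head \<Sigma>) U @ [head \<Sigma> h])"
    using assms(1) by (auto simp: path_between_def)
  then have "distinct ((a # map (head \<Sigma>) U) @ [head \<Sigma> h])" "walk \<Sigma> a U (tail \<Sigma> h)"
    by simp_all
  then have "distinct ((map (tail \<Sigma>) U @ [tail \<Sigma> h]) @ [head \<Sigma> h])"
    by (simp only: walk_tails_heads)
  then show ?thesis
    by auto
qed

lemma mem_end_verts: "e \<in> C \<Longrightarrow> attach \<Sigma> (e, b) \<in> end_verts \<Sigma> C"
  by (auto simp: end_verts_def)

text \<open>Path edges occur twice and cancel. What remains is the sign of a balanced cycle, or the
  product of the signs of two edge-disjoint unbalanced cycles.\<close>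

lemma circuit_walk_sign:
  assumes "circuit_walk \<Sigma> W"
  shows "closed_walk \<Sigma> W" "walk_sign \<Sigma> W = 1"
proof -
  obtain C P where CP: "circuit \<Sigma> C P" "closed_walk \<Sigma> W" "set (edge_list W) = C"
    and count: "\<forall>e\<in>C. count_list (edge_list W) e = (if e \<in> P then 2 else 1)"
    using assms by (auto simp: circuit_walk_def)
  show "closed_walk \<Sigma> W" by fact
  have C: "finite C" "C \<subseteq> edges \<Sigma>"
    using CP by (auto simp: closed_walk_def edge_list_def dest: walk_edges)
  have "walk_sign \<Sigma> W = (\<Prod>e\<in>C. esign \<Sigma> e ^ count_list (edge_list W) e)"
    using prod_list_count_list[of C "edge_list W" "esign \<Sigma>"] C CP(3)
    by (simp add: walk_sign_def edge_list_def o_def)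
  also have "\<dots> = (\<Prod>e\<in>C. if e \<in> P then 1 else esign \<Sigma> e)"
  proof (intro prod.cong refl)
    fix e assume "e \<in> C"
    then have "esign \<Sigma> e = 1 \<or> esign \<Sigma> e = -1"
      using C(2) esign_cases by blast
    with \<open>e \<in> C\<close> count
    show "esign \<Sigma> e ^ count_list (edge_list W) e = (if e \<in> P then 1 else esign \<Sigma> e)"
      by auto
  qed
  also have "\<dots> = (\<Prod>e\<in>C - P. esign \<Sigma> e)"
    using C(1) by (simp add: prod.If_cases Diff_eq)
  also have "\<dots> = 1"
    using CP(1)
  proof cases
    case balanced_cycle
    then show ?thesis by (auto simp: balanced_cycle_def)
  next
    case (tight_handcuff C1 C2 v)
    \<comment> \<open>A common edge would have both ends at the shared vertex, hence be a loop, and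
      both cycles would equal it.\<close>
    have "C1 \<inter> C2 = {}"
    proof (rule ccontr)
      assume "C1 \<inter> C2 \<noteq> {}"
      then obtain e where e: "e \<in> C1" "e \<in> C2" by auto
      then have "attach \<Sigma> (e, b) = v" for b
        using tight_handcuff(6) mem_end_verts by blast
      then show False
        using cycle_loop[of C1 e] cycle_loop[of C2 e] e tight_handcuff
        by (auto simp: unbalanced_cycle_def)
    qed
    then show ?thesis
      using tight_handcuff C(1) unbalanced_cycle_prod by (simp add: prod.union_disjoint)
  next
    case (loose_handcuff C1 C2 u V v)
    have P: "attach \<Sigma> (e, False) \<noteq> attach \<Sigma> (e, True)" if e: "e \<in> P" for e
    proof -
      obtain b where "(e, b) \<in> set V"
        using e loose_handcuff by (auto simp: edge_list_def)
      then have "head \<Sigma> (e, b) \<noteq> tail \<Sigma> (e, b)"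
        using path_between_no_loop[OF loose_handcuff(5)] by blast
      then show ?thesis
        by (cases b) (simp_all add: head_def tail_def)
    qed
    have "C1 \<inter> C2 = {}"
      using loose_handcuff(4) mem_end_verts by blast
    \<comment> \<open>A path edge inside a cycle would have both ends at the only common vertex, but
      path edges are not loops.\<close>
    moreover have "e \<notin> C'" if "e \<in> P" "end_verts \<Sigma> P \<inter> end_verts \<Sigma> C' = {x}" for e C' x
    proof
      assume "e \<in> C'"
      then have "attach \<Sigma> (e, b) = x" for b
        using that mem_end_verts by blast
      then show False
        using P[OF that(1)] by simp
    qed
    then have "P \<inter> C1 = {}" "P \<inter> C2 = {}"
      using loose_handcuff(7,8) by blast+
    ultimately have "C - P = C1 \<union> C2" "C1 \<inter> C2 = {}"
      using loose_handcuff(1) by auto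
    then show ?thesis
      using loose_handcuff C(1) unbalanced_cycle_prod by (simp add: prod.union_disjoint)
  qed
  finally show "walk_sign \<Sigma> W = 1" .
qed

text \<open>A later use of the first edge would visit the start of the path again.\<close>

lemma path_distinct_edges:
  "walk \<Sigma> a W b \<Longrightarrow> distinct (a # map (head \<Sigma>) W) \<Longrightarrow> distinct (edge_list W)"
proof (induction W arbitrary: a)
  case (Cons h W)
  have "fst g \<noteq> fst h" if g: "g \<in> set W" for g
  proof
    assume "fst g = fst h"
    then have "tail \<Sigma> h = tail \<Sigma> g \<or> tail \<Sigma> h = head \<Sigma> g"
      by (cases g; cases h; cases "snd g = snd h") (auto simp: tail_def head_def)
    moreover have "set (map (tail \<Sigma>) W) \<subseteq> set (head \<Sigma> h # map (head \<Sigma>) W)"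
      using Cons.prems(1) walk_tails_heads[of "head \<Sigma> h" W b]
      by (metis Un_upper1 set_append walk.simps(2))
    ultimately show False
      using g Cons.prems by auto
  qed
  then have "fst h \<notin> set (map fst W)"
    by fastforce
  moreover have "distinct (edge_list W)"
    using Cons.IH[of "head \<Sigma> h"] Cons.prems by simp
  ultimately show ?case
    by (simp add: edge_list_def)
qed (simp add: edge_list_def)

lemma count_list_distinct: "distinct xs \<Longrightarrow> count_list xs x = (if x \<in> set xs then 1 else 0)"
  by (induction xs) auto

text \<open>The walk goes around a tight handcuff if \<open>Q\<close> is empty and around a loose
  one otherwise. The condition \<open>tight\<close> excludes two copies of one loop, which share a
  single vertex without forming a handcuff.\<close>

lemma handcuff_circuit_walk:
  assumes C1: "walk \<Sigma> v C1 v" "distinct (map (tail \<Sigma>) C1)" "walk_sign \<Sigma> C1 = -1"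
    and Q: "walk \<Sigma> v Q w" "distinct (map (tail \<Sigma>) (Q @ C2))"
    and C2: "walk \<Sigma> w C2 w" "walk_sign \<Sigma> C2 = -1"
    and disj: "set (map (tail \<Sigma>) C1) \<inter> set (map (tail \<Sigma>) (Q @ C2)) \<subseteq> {v}"
    and tight: "Q = [] \<Longrightarrow> set (edge_list C1) \<inter> set (edge_list C2) = {}"
  shows "circuit_walk \<Sigma> (C1 @ Q @ C2 @ rev_walk Q)"
proof -
  let ?E = "\<lambda>W. set (edge_list W)"
  have C2': "distinct (map (tail \<Sigma>) C2)"
    using Q(2) by simp
  note u1 = negative_cycle[OF C1] and u2 = negative_cycle[OF C2(1) C2' C2(2)]
  have ne: "C1 \<noteq> []" "C2 \<noteq> []"
    using C1(3) C2(2) by auto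
  have v: "v \<in> set (map (tail \<Sigma>) C1)"
    using C1(1) ne by (cases C1) auto
  have w: "w \<in> set (map (tail \<Sigma>) C2)"
    using C2(1) ne by (cases C2) auto
  note ev1 = end_verts_closed_walk[OF C1(1) ne(1)] and ev2 = end_verts_closed_walk[OF C2(1) ne(2)]
  have "walk \<Sigma> v (C1 @ Q @ C2 @ rev_walk Q) v"
    unfolding walk_append using C1(1) Q(1) C2(1) walk_rev[OF Q(1)] by blast
  then have walk: "closed_walk \<Sigma> (C1 @ Q @ C2 @ rev_walk Q)"
    by (auto simp: closed_walk_def simp del: walk_append)
  have edges: "edge_list (C1 @ Q @ C2 @ rev_walk Q) =
      edge_list C1 @ edge_list Q @ edge_list C2 @ rev (edge_list Q)"
    by (simp add: edge_list_def)
  note cnt = count_list_distinct[OF u1(1)] count_list_distinct[OF u2(1)]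
  show ?thesis
  proof (cases "Q = []")
    case True
    then have [simp]: "w = v"
      using Q(1) by auto
    have "end_verts \<Sigma> (?E C1) \<inter> end_verts \<Sigma> (?E C2) = {v}"
      using disj v w True unfolding ev1 ev2 by auto
    moreover have "?E C1 \<noteq> ?E C2"
      using tight[OF True] ne by (cases C1) (auto simp: edge_list_def)
    ultimately have "circuit \<Sigma> (?E C1 \<union> ?E C2) {}"
      by (intro circuit.tight_handcuff[OF u1(2) u2(2)])
    moreover have "\<forall>e\<in>?E C1 \<union> ?E C2. count_list (edge_list C1 @ edge_list C2) e = 1"
      using tight[OF True] by (auto simp: cnt)
    ultimately show ?thesis
      unfolding circuit_walk_def using walk edges True
      by (intro exI[of _ "?E C1 \<union> ?E C2"] exI[of _ "{}"]) (simp add: edge_list_def)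
  next
    case False
    \<comment> \<open>Since \<open>v\<close> is a tail of \<open>Q\<close>, distinctness keeps it
      off \<open>C2\<close>; with \<open>disj\<close> the two cycles become vertex-disjoint.\<close>
    have vQ: "v \<in> set (map (tail \<Sigma>) Q)"
      using False Q(1) by (cases Q) auto
    \<comment> \<open>As \<open>w\<close> is a tail of \<open>C2\<close>, no tail of
      \<open>Q\<close> equals it, so the path does not meet its last vertex early.\<close>
    have "distinct (map (tail \<Sigma>) Q @ [w])"
      using Q(2) w by auto
    then have dist: "distinct (v # map (head \<Sigma>) Q)"
      by (simp only: walk_tails_heads[OF Q(1)])
    then have path: "path_between \<Sigma> v Q w"
      using Q(1) by (simp add: path_between_def)
    have evQ: "end_verts \<Sigma> (?E Q) = insert w (set (map (tail \<Sigma>) Q))"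
      using end_verts_walk[OF Q(1) False] .
    have int1: "end_verts \<Sigma> (?E C1) \<inter> end_verts \<Sigma> (?E C2) = {}"
      using disj vQ Q(2) unfolding ev1 ev2 by auto
    have int2: "end_verts \<Sigma> (?E Q) \<inter> end_verts \<Sigma> (?E C1) = {v}"
      using disj v vQ w unfolding ev1 evQ by auto
    have int3: "end_verts \<Sigma> (?E Q) \<inter> end_verts \<Sigma> (?E C2) = {w}"
      using w Q(2) unfolding ev2 evQ by auto
    have circuit: "circuit \<Sigma> (?E C1 \<union> ?E Q \<union> ?E C2) (?E Q)"
      using circuit.loose_handcuff[OF u1(2) u2(2) int1 path refl int2 int3] .
    have no_common: "e \<notin> C" if "e \<in> ?E Q" "end_verts \<Sigma> (?E Q) \<inter> end_verts \<Sigma> C = {x}" for e C x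
    proof
      assume "e \<in> C"
      then have "attach \<Sigma> (e, b) = x" for b
        using that mem_end_verts by blast
      moreover obtain b where "(e, b) \<in> set Q"
        using \<open>e \<in> ?E Q\<close> by (auto simp: edge_list_def)
      ultimately show False
        using path_between_no_loop[OF path, of "(e, b)"] by (simp add: head_def tail_def)
    qed
    have "?E C1 \<inter> ?E C2 = {}"
      using int1 mem_end_verts by blast
    moreover have "?E Q \<inter> ?E C1 = {}" "?E Q \<inter> ?E C2 = {}"
      using no_common[OF _ int2] no_common[OF _ int3] by blast+
    moreover note cnt count_list_distinct[OF path_distinct_edges[OF Q(1) dist]]
    ultimately have "\<forall>e\<in>?E C1 \<union> ?E Q \<union> ?E C2.
        count_list (edge_list C1 @ edge_list Q @ edge_list C2 @ rev (edge_list Q)) e =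
        (if e \<in> ?E Q then 2 else 1)"
      by (simp del: set_map) blast
    then show ?thesis
      unfolding circuit_walk_def using walk circuit edges
      by (intro exI[of _ "?E C1 \<union> ?E Q \<union> ?E C2"] exI[of _ "?E Q"]) (simp add: Un_ac)
  qed
qed

end

section \<open>Sums along walks\<close>

locale oriented_signed_graph = finite_signed_graph \<Sigma> for \<Sigma> :: "('v, 'e) signed_graph" +
  fixes \<omega> :: "'e \<times> bool \<Rightarrow> int"
  assumes compatible: "compatible_orientation \<Sigma> \<omega>"
begin

lemma orientation_cases: "e \<in> edges \<Sigma> \<Longrightarrow> \<omega> (e, b) = 1 \<or> \<omega> (e, b) = -1"
  using compatible by (auto simp: compatible_orientation_def)

lemma orientation_reverse: "e \<in> edges \<Sigma> \<Longrightarrow> \<omega> (e, \<not> b) = - esign \<Sigma> e * \<omega> (e, b)"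
  using compatible orientation_cases[of e False] orientation_cases[of e True]
  by (cases b) (auto simp: compatible_orientation_def)

lemma walk_sum_append:
  "walk \<Sigma> a V b \<Longrightarrow>
   walk_sum \<Sigma> \<omega> f (V @ W) = walk_sum \<Sigma> \<omega> f V + sign_scale (walk_sign \<Sigma> V) (walk_sum \<Sigma> \<omega> f W)"
proof (induction V arbitrary: a)
  case (Cons h V)
  then have "walk \<Sigma> (head \<Sigma> h) V b" "fst h \<in> edges \<Sigma>"
    by auto
  with Cons.IH walk_sign_cases[of "head \<Sigma> h" V b] esign_cases[of "fst h"] show ?case
    by (auto simp: add.assoc)
qed simp

lemma walk_sum_rev:
  "walk \<Sigma> a W b \<Longrightarrow>
   walk_sum \<Sigma> \<omega> f (rev_walk W) = - sign_scale (walk_sign \<Sigma> W) (walk_sum \<Sigma> \<omega> f W)"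
proof (induction W arbitrary: a)
  case (Cons h W)
  then have W: "walk \<Sigma> (head \<Sigma> h) W b" and h: "fst h \<in> edges \<Sigma>"
    by auto
  have "\<omega> (fst h, \<not> snd h) = - esign \<Sigma> (fst h) * \<omega> h"
    using orientation_reverse[OF h, of "snd h"] by simp
  with Cons.IH[OF W] walk_sum_append[OF walk_rev[OF W], of f "[(fst h, \<not> snd h)]"] walk_sign_cases[OF W]
    esign_cases[OF h] orientation_cases[OF h, of "snd h"] show ?case
    by (auto simp: algebra_simps)
qed simp

text \<open>\<open>sign_scale\<close> treats every value other than 1 as -1, so its multiplicativity
  rests on all factors lying in \<open>{-1, 1}\<close>, which the walk guarantees.\<close>

lemma walk_sum_eq_sum:
  "walk \<Sigma> a W b \<Longrightarrow>
   (\<Sum>i<length W. sign_scale (\<omega> (W ! i) * (\<Prod>j<i. esign \<Sigma> (edge_list W ! j))) (f (edge_list W ! i)))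
     = walk_sum \<Sigma> \<omega> f W"
proof (induction W arbitrary: a)
  case (Cons h W)
  then have W: "walk \<Sigma> (head \<Sigma> h) W b" and h: "fst h \<in> edges \<Sigma>"
    by auto
  have "sign_scale (\<omega> (W ! i) * (\<Prod>j<Suc i. esign \<Sigma> (edge_list (h # W) ! j))) x =
      sign_scale (esign \<Sigma> (fst h)) (sign_scale (\<omega> (W ! i) * (\<Prod>j<i. esign \<Sigma> (edge_list W ! j))) x)"
    if i: "i < length W" for i and x :: 'a
  proof -
    have edge: "edge_list W ! j \<in> edges \<Sigma>" if "j < length W" for j
      using that walk_edges[OF W] by (simp add: edge_list_def)
    have "(\<Prod>j<k. esign \<Sigma> (edge_list W ! j)) \<in> {-1, 1}" if "k \<le> length W" for k
      using that
    proof (induction k)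
      case (Suc k)
      then show ?case
        using esign_cases[OF edge, of k] by auto
    qed simp
    then have "(\<Prod>j<i. esign \<Sigma> (edge_list W ! j)) \<in> {-1, 1}"
      using i by simp
    moreover have "\<omega> (W ! i) \<in> {-1, 1}"
      using orientation_cases[of "fst (W ! i)" "snd (W ! i)"] edge[OF i] i by (auto simp: edge_list_def)
    ultimately show ?thesis
      using esign_cases[OF h]
      by (auto simp: prod.lessThan_Suc_shift edge_list_def simp del: prod.lessThan_Suc)
  qed
  then have "(\<Sum>i<length W. sign_scale (\<omega> (W ! i) * (\<Prod>j<Suc i. esign \<Sigma> (edge_list (h # W) ! j)))
        (f (edge_list W ! i))) = sign_scale (esign \<Sigma> (fst h)) (walk_sum \<Sigma> \<omega> f W)"
    using Cons.IH[OF W] esign_cases[OF h] by (auto simp: sum_negf)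
  then show ?case
    by (simp add: sum.lessThan_Suc_shift edge_list_def del: sum.lessThan_Suc prod.lessThan_Suc)
qed simp

lemma tension_iff:
  "tension \<Sigma> \<omega> f \<longleftrightarrow> (\<forall>W. circuit_walk \<Sigma> W \<longrightarrow> walk_sum \<Sigma> \<omega> f W = 0)"
proof -
  have "(\<Sum>i<length W. sign_scale (\<omega> (W ! i) * (\<Prod>j<i. esign \<Sigma> (edge_list W ! j)))
      (f (edge_list W ! i))) = walk_sum \<Sigma> \<omega> f W" if "circuit_walk \<Sigma> W" for W
  proof -
    obtain v where "walk \<Sigma> v W v"
      using circuit_walk_sign(1)[OF \<open>circuit_walk \<Sigma> W\<close>] by (auto simp: closed_walk_def)
    then show ?thesis
      by (rule walk_sum_eq_sum)
  qed
  then show ?thesis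
    by (simp add: tension_def)
qed

lemma walk_sum_backtrack: "walk \<Sigma> a W b \<Longrightarrow> walk_sum \<Sigma> \<omega> f (W @ rev_walk W) = 0"
  using walk_sign_cases[of a W b] by (auto simp: walk_sum_append walk_sum_rev)

lemma tension_positive_closed_walk:
  fixes f :: "'e \<Rightarrow> 'g::ab_group_add"
  assumes tension: "tension \<Sigma> \<omega> f" and "walk \<Sigma> v W v" "walk_sign \<Sigma> W = 1"
  shows "walk_sum \<Sigma> \<omega> f W = 0"
  using assms(2,3)
proof (induction "length W" arbitrary: v W rule: less_induct)
  case less
  let ?S = "walk_sum \<Sigma> \<omega> f" and ?s = "walk_sign \<Sigma>"
  have circuit: "?S V = 0" if "circuit_walk \<Sigma> V" for V
    using tension that by (simp add: tension_iff)
  \<comment> \<open>Going along \<open>X\<close> and back along \<open>Y\<close> is a positive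
    closed walk shorter than \<open>W\<close>, so the induction hypothesis equates the two
    sums.\<close>
  have parallel: "?S X = ?S Y"
    if X: "walk \<Sigma> a X b" and Y: "walk \<Sigma> a Y b" and "?s X = ?s Y" "length X + length Y < length W"
    for a b X Y
  proof -
    have "?S (X @ rev_walk Y) = 0"
    proof (rule less(1))
      show "walk \<Sigma> a (X @ rev_walk Y) a"
        using X walk_rev[OF Y] by auto
      show "?s (X @ rev_walk Y) = 1"
        using that(3) walk_sign_cases[OF Y] by auto
    qed (use that(4) in simp)
    then show ?thesis
      using that(3) walk_sign_cases[OF Y] by (auto simp: walk_sum_append[OF X] walk_sum_rev[OF Y])
  qed
  show ?case
  proof (cases "W = []")
    case False
    obtain Q0 C0 R0 w where W: "W = Q0 @ C0 @ R0" and Q0: "walk \<Sigma> v Q0 w" and C0: "walk \<Sigma> w C0 w"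
      and R0: "walk \<Sigma> w R0 v" and C0': "C0 \<noteq> []" "distinct (map (tail \<Sigma>) (Q0 @ C0))"
      using first_return[OF less(2) False] by metis
    \<comment> \<open>Rotating \<open>W\<close> to start at \<open>w\<close> puts \<open>C0\<close>
      first and changes the sum only by the sign of \<open>Q0\<close>.\<close>
    define W2 where "W2 = R0 @ Q0"
    have W2: "walk \<Sigma> w W2 w"
      unfolding W2_def walk_append using Q0 R0 by blast
    have dist0: "distinct (map (tail \<Sigma>) C0)"
      using C0' by simp
    have len: "length W = length C0 + length W2"
      by (simp add: W W2_def)
    have sgn: "?s C0 * ?s W2 = 1"
      using less(3) by (simp add: W W2_def mult_ac)
    have rotate: "?S W = sign_scale (?s Q0) (?S (C0 @ W2))"
      using walk_sign_cases[OF Q0] walk_sign_cases[OF C0] walk_sign_cases[OF R0] less(3)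
      by (auto simp: W W2_def walk_sum_append[OF Q0] walk_sum_append[OF C0] walk_sum_append[OF R0])
    have "?S (C0 @ W2) = 0"
    proof (cases "W2 = []")
      case True
      \<comment> \<open>Here \<open>W\<close> is \<open>C0\<close> itself: a balanced cycle, or an
        edge traversed back and forth.\<close>
      show ?thesis
      proof (cases "distinct (edge_list C0)")
        case dist: True
        have "balanced_cycle \<Sigma> (set (edge_list C0))"
          using cycleI[OF C0 dist0 dist C0'(1)] walk_sign_eq_prod[OF dist, of \<Sigma>] sgn True
          by (simp add: balanced_cycle_def)
        then have "circuit_walk \<Sigma> C0"
          unfolding circuit_walk_def closed_walk_def
          using circuit.balanced_cycle C0 dist by (fastforce simp: count_list_distinct)
        then show ?thesis
          using True circuit by simp
      next
        case False
        then obtain e b where "C0 = [(e, b), (e, \<not> b)]"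
          using closed_walk_distinct_edges[OF C0 dist0] by blast
        then have "C0 = [(e, b)] @ rev_walk [(e, b)]" "walk \<Sigma> w [(e, b)] (head \<Sigma> (e, b))"
          using C0 by (auto simp: tail_verts head_verts)
        then show ?thesis
          using True walk_sum_backtrack by fastforce
      qed
    next
      case W2ne: False
      show ?thesis
      proof (cases "?s C0 = 1")
        case True
        \<comment> \<open>If \<open>C0\<close> is positive, so is \<open>W2\<close>, and both are
          shorter than \<open>W\<close>.\<close>
        then have "?S C0 = 0" "?S W2 = 0"
          using less(1)[OF _ C0] less(1)[OF _ W2] sgn W2ne C0'(1) len by auto
        then show ?thesis
          by (simp add: walk_sum_append[OF C0])
      next
        case False
        then have s0: "?s C0 = -1" and s2: "?s W2 = -1"
          using walk_sign_cases[OF C0] sgn by auto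
        obtain Q C R x where W2_eq: "W2 = Q @ C @ R" and Q: "walk \<Sigma> w Q x" and C: "walk \<Sigma> x C x"
          and R: "walk \<Sigma> x R w" and C': "C \<noteq> []" "distinct (map (tail \<Sigma>) (Q @ C))"
          using first_return[OF W2 W2ne] by metis
        note split = walk_sum_append[OF C0] walk_sum_append[OF Q] walk_sum_append[OF C]
          walk_sum_append[OF R]
        show ?thesis
        proof (cases "?s C = 1")
          case True
          \<comment> \<open>A positive \<open>C\<close> contributes nothing and can be cut out,
            leaving a shorter positive closed walk.\<close>
          have "?S C = 0"
            using less(1)[OF _ C] True len C0'(1) by (simp add: W2_eq)
          moreover have "?S (C0 @ Q @ R) = 0"
          proof (rule less(1))
            show "walk \<Sigma> w (C0 @ Q @ R) w"
              unfolding walk_append using C0 Q R by blast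
            show "?s (C0 @ Q @ R) = 1"
              using sgn True by (simp add: W2_eq)
          qed (use C'(1) len in \<open>simp add: W2_eq\<close>)
          ultimately show ?thesis
            using True by (simp add: W2_eq split)
        next
          case False
          then have sC: "?s C = -1"
            using walk_sign_cases[OF C] by auto
          then have sQR: "?s Q = ?s R"
            using s2 walk_sign_cases[OF Q] walk_sign_cases[OF R] by (auto simp: W2_eq)
          \<comment> \<open>Both walks lead from \<open>x\<close> to \<open>w\<close> with equal
            signs, and they are short enough because \<open>C0\<close> and \<open>C\<close> are
            nonempty.\<close>
          have "?S R = ?S (rev_walk Q)"
            using parallel[OF R walk_rev[OF Q]] sQR C'(1) len by (simp add: W2_eq)
          then have handcuff: "?S (C0 @ W2) = ?S (C0 @ Q @ C @ rev_walk Q)"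
            by (simp add: W2_eq split)
          show ?thesis
          proof (cases "set (map (tail \<Sigma>) C0) \<inter> set (map (tail \<Sigma>) W2) \<subseteq> {w}")
            case False
            \<comment> \<open>Two closed walks sharing a second vertex \<open>y\<close> recombine into two shorter positive ones.\<close>
            then obtain y where y: "y \<noteq> w" "y \<in> set (map (tail \<Sigma>) C0)" "y \<in> set (map (tail \<Sigma>) W2)"
              by blast
            obtain A B where AB: "C0 = A @ B" and A: "walk \<Sigma> w A y" and B: "walk \<Sigma> y B w"
              using walk_split_at_tail[OF C0 y(2)] by blast
            obtain D F where DF: "W2 = D @ F" and D: "walk \<Sigma> w D y" and F: "walk \<Sigma> y F w"
              using walk_split_at_tail[OF W2 y(3)] by blast
            have "A \<noteq> []" "B \<noteq> []" "D \<noteq> []" "F \<noteq> []"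
              using A B D F y(1) by auto
            then have "length A + length D < length W" "length B + length F < length W"
              "length A + length F < length W" "length D + length B < length W"
              using len by (auto simp: AB DF)
            note par = parallel[OF A D _ this(1)] parallel[OF B F _ this(2)]
              parallel[OF A walk_rev[OF F]] parallel[OF D walk_rev[OF B]]
            have AB': "?s A * ?s B = -1" and DF': "?s D * ?s F = -1"
              using s0 s2 by (auto simp: AB DF)
            \<comment> \<open>Walks of equal sign are compared: \<open>A\<close> with
              \<open>D\<close> and \<open>B\<close> with \<open>F\<close>, or else \<open>A\<close>
              with the reverse of \<open>F\<close> and \<open>D\<close> with the reverse of
              \<open>B\<close>.\<close>
            show ?thesis
            proof (cases "?s A = ?s D")
              case True
              then have "?s B = ?s F"
                using AB' DF' walk_sign_cases[OF D] by auto
              then show ?thesis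
                using par(1,2) True AB' walk_sign_cases[OF A] walk_sign_cases[OF B]
                by (auto simp: AB DF walk_sum_append[OF A] walk_sum_append[OF B]
                    walk_sum_append[OF D] sign_scale_add)
            next
              case False
              then have *: "?s A = ?s F" "?s D = ?s B" "?s B = - ?s A"
                using AB' DF' walk_sign_cases[OF A] walk_sign_cases[OF B] walk_sign_cases[OF D] walk_sign_cases[OF F]
                by auto
              then have "?S A = - sign_scale (?s F) (?S F)" "?S D = - sign_scale (?s B) (?S B)"
                using par(3,4) \<open>length A + length F < length W\<close> \<open>length D + length B < length W\<close>
                by (simp_all add: walk_sum_rev[OF F] walk_sum_rev[OF B])
              then show ?thesis
                using * walk_sign_cases[OF A]
                by (auto simp: AB DF walk_sum_append[OF A] walk_sum_append[OF B]
                    walk_sum_append[OF D] sign_scale_add)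
            qed
          next
            case True
            then have disj: "set (map (tail \<Sigma>) C0) \<inter> set (map (tail \<Sigma>) (Q @ C)) \<subseteq> {w}"
              by (auto simp: W2_eq)
            show ?thesis
            proof (cases "Q = [] \<and> set (edge_list C0) \<inter> set (edge_list C) \<noteq> {}")
              case True
              \<comment> \<open>Both cycles are the same loop, which is not a handcuff.\<close>
              then have [simp]: "Q = []" "x = w"
                using Q by auto
              obtain e b c where e: "(e, b) \<in> set C0" "(e, c) \<in> set C"
                using True by (auto simp: edge_list_def)
              have dC: "distinct (map (tail \<Sigma>) C)"
                using C' by simp
              have "attach \<Sigma> (e, d) \<in> {w}" for d
                using disj mem_end_verts[of e "set (edge_list C0)" d] mem_end_verts[of e "set (edge_list C)" d] e
                unfolding end_verts_closed_walk[OF C0 C0'(1)] end_verts_closed_walk[OF C C'(1)]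
                by (force simp: edge_list_def)
              then have "C0 = [(e, b)]" "C = [(e, c)]"
                using closed_walk_loop[OF C0 dist0 e(1)] closed_walk_loop[OF C dC e(2)]
                by (auto simp: head_def tail_def)
              moreover have "C = C0 \<or> C = rev_walk C0"
                using calculation by auto
              \<comment> \<open>Reversing a negative closed walk preserves its sum, so the direction
                of the loop is irrelevant; the sign of \<open>C0\<close> then makes the two
                contributions cancel.\<close>
              ultimately have "?S C = ?S C0"
                using walk_sum_rev[OF C0, of f] s0 by auto
              then show ?thesis
                unfolding handcuff using s0 by (simp add: walk_sum_append[OF C0])
            next
              case False
              then show ?thesis
                using circuit[OF handcuff_circuit_walk[OF C0 dist0 s0 Q C'(2) C sC disj]] handcuff
                by auto
            qed
          qed
        qed
      qed
    qed
    then show ?thesis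
      using rotate by simp
  qed simp
qed

end

section \<open>The subgroup of doubles\<close>

lemma doubles_0: "0 \<in> doubles"
  unfolding doubles_def by (rule range_eqI[of _ _ 0]) simp

lemma doubles_double: "x + x \<in> doubles"
  by (simp add: doubles_def)

lemma doubles_add: "x \<in> doubles \<Longrightarrow> y \<in> doubles \<Longrightarrow> x + y \<in> (doubles :: 'g::ab_group_add set)"
proof -
  have "(a + a) + (b + b) \<in> doubles" for a b :: 'g
    using doubles_double[of "a + b"] by (simp add: algebra_simps)
  then show "x \<in> doubles \<Longrightarrow> y \<in> doubles \<Longrightarrow> x + y \<in> doubles"
    by (auto simp: doubles_def)
qed

lemma doubles_uminus: "x \<in> doubles \<Longrightarrow> - x \<in> (doubles :: 'g::ab_group_add set)"
proof -
  have "- (a + a) \<in> doubles" for a :: 'g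
    using doubles_double[of "- a"] by simp
  then show "x \<in> doubles \<Longrightarrow> - x \<in> doubles"
    by (auto simp: doubles_def)
qed

lemma doubles_diff: "x \<in> doubles \<Longrightarrow> y \<in> doubles \<Longrightarrow> x - y \<in> doubles"
  using doubles_add[of x "- y"] doubles_uminus[of y] by simp

lemma mem_doubles_coset: "x \<in> (+) u ` doubles \<longleftrightarrow> x - u \<in> (doubles :: 'g::ab_group_add set)"
  by (auto simp: image_iff algebra_simps intro: bexI[of _ "x - u"])

lemma sign_scale_diff_doubles: "sign_scale s x - x \<in> doubles"
  using doubles_0 doubles_uminus[OF doubles_double[of x]] by (auto simp: sign_scale_def)

section \<open>Sums along negative closed walks modulo doubles\<close>

context oriented_signed_graph
begin

text \<open>Signs are invisible modulo doubles, as \<open>x\<close> and \<open>- x\<close> differ by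
  \<open>x + x\<close>. Hence the unsigned cycle conditions can be stated with
  \<open>walk_sum\<close>.\<close>

lemma walk_sum_mod_doubles:
  fixes f :: "'e \<Rightarrow> 'g::ab_group_add"
  shows "walk_sum \<Sigma> \<omega> f W - (\<Sum>e\<leftarrow>edge_list W. f e) \<in> doubles"
proof (induction W)
  case (Cons h W)
  have "walk_sum \<Sigma> \<omega> f (h # W) - (\<Sum>e\<leftarrow>edge_list (h # W). f e) =
      (sign_scale (\<omega> h) (f (fst h)) - f (fst h)) +
      ((sign_scale (esign \<Sigma> (fst h)) (walk_sum \<Sigma> \<omega> f W) - walk_sum \<Sigma> \<omega> f W) +
       (walk_sum \<Sigma> \<omega> f W - (\<Sum>e\<leftarrow>edge_list W. f e)))"
    by (simp add: edge_list_def algebra_simps)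
  then show ?case
    using doubles_add sign_scale_diff_doubles Cons by metis
qed (simp add: edge_list_def doubles_0)

lemma walk_sum_mod_doubles_coset:
  "(\<Sum>e\<leftarrow>edge_list W. f e) \<in> (+) u ` doubles \<longleftrightarrow> walk_sum \<Sigma> \<omega> f W - u \<in> doubles"
proof -
  have "walk_sum \<Sigma> \<omega> f W - u =
      (walk_sum \<Sigma> \<omega> f W - (\<Sum>e\<leftarrow>edge_list W. f e)) + ((\<Sum>e\<leftarrow>edge_list W. f e) - u)"
    "(\<Sum>e\<leftarrow>edge_list W. f e) - u =
      (walk_sum \<Sigma> \<omega> f W - u) - (walk_sum \<Sigma> \<omega> f W - (\<Sum>e\<leftarrow>edge_list W. f e))"
    by simp_all
  then show ?thesis
    unfolding mem_doubles_coset using walk_sum_mod_doubles[of f W] doubles_add doubles_diff by metis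
qed

text \<open>Because \<open>W\<close> is negative, the way out and the way back along
  \<open>Q\<close> contribute the same element, and together a double.\<close>

lemma walk_sum_conjugate:
  fixes f :: "'e \<Rightarrow> 'g::ab_group_add"
  assumes "walk \<Sigma> a Q b" "walk \<Sigma> b W b" "walk_sign \<Sigma> W = -1"
  shows "walk_sum \<Sigma> \<omega> f (Q @ W @ rev_walk Q) - walk_sum \<Sigma> \<omega> f W \<in> doubles"
proof -
  let ?S = "walk_sum \<Sigma> \<omega> f"
  have "?S (Q @ W @ rev_walk Q) - ?S W =
      (?S Q + ?S Q) + (sign_scale (walk_sign \<Sigma> Q) (?S W) - ?S W)"
    using walk_sign_cases[OF assms(1)] assms(3)
    by (auto simp: walk_sum_append[OF assms(1)] walk_sum_append[OF assms(2)] walk_sum_rev[OF assms(1)]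
        algebra_simps)
  then show ?thesis
    using doubles_add doubles_double sign_scale_diff_doubles by metis
qed

lemma unbalanced_cycle_walk_sign: "unbalanced_cycle_walk \<Sigma> W \<Longrightarrow> walk_sign \<Sigma> W = -1"
  using unbalanced_cycle_prod by (simp add: unbalanced_cycle_walk_def walk_sign_eq_prod)

text \<open>Induction on the length by first return: a positive \<open>C\<close> has sum zero and is
  cut out, and a negative \<open>C\<close> makes the sum of \<open>W\<close> that of a conjugate of
  an unbalanced cycle.\<close>

lemma tension_negative_closed_walk:
  fixes f :: "'e \<Rightarrow> 'g::ab_group_add"
  assumes tension: "tension \<Sigma> \<omega> f"
    and coset: "\<And>W. unbalanced_cycle_walk \<Sigma> W \<Longrightarrow> (\<Sum>e\<leftarrow>edge_list W. f e) \<in> (+) u ` doubles"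
    and "walk \<Sigma> v W v" "walk_sign \<Sigma> W = -1"
  shows "walk_sum \<Sigma> \<omega> f W - u \<in> doubles"
  using assms(3,4)
proof (induction "length W" arbitrary: v W rule: less_induct)
  case less
  let ?S = "walk_sum \<Sigma> \<omega> f" and ?s = "walk_sign \<Sigma>"
  have "W \<noteq> []"
    using less(3) by auto
  then obtain Q C R w where W: "W = Q @ C @ R" and Q: "walk \<Sigma> v Q w" and C: "walk \<Sigma> w C w"
    and R: "walk \<Sigma> w R v" and C': "C \<noteq> []" "distinct (map (tail \<Sigma>) (Q @ C))"
    using first_return[OF less(2)] by metis
  have QR: "walk \<Sigma> v (Q @ R) v"
    unfolding walk_append using Q R by blast
  show ?case
  proof (cases "?s C = 1")
    case True
    then have "?S C = 0"
      using tension_positive_closed_walk[OF tension C] by simp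
    then have "?S W = ?S (Q @ R)"
      using True by (simp add: W walk_sum_append[OF Q] walk_sum_append[OF C])
    then show ?thesis
      using less(1)[OF _ QR] less(3) C'(1) True by (simp add: W)
  next
    case False
    then have sC: "?s C = -1"
      using walk_sign_cases[OF C] by auto
    then have sQR: "?s Q = ?s R"
      using less(3) walk_sign_cases[OF Q] walk_sign_cases[OF R] by (auto simp: W)
    then have "?s (Q @ R) = 1"
      using walk_sign_cases[OF R] by auto
    then have "?S (Q @ R) = 0"
      using tension_positive_closed_walk[OF tension QR] by blast
    \<comment> \<open>The vanishing sum of \<open>Q @ R\<close> says that \<open>R\<close> and
      \<open>rev_walk Q\<close> have equal sums.\<close>
    then have "?S W = ?S (Q @ C @ rev_walk Q)"
      using sC walk_sign_cases[OF Q]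
      by (auto simp: W walk_sum_append[OF Q] walk_sum_append[OF C] walk_sum_rev[OF Q] add_eq_0_iff2)
    then have "?S W - ?S C \<in> doubles"
      using walk_sum_conjugate[OF Q C sC] by metis
    moreover have "unbalanced_cycle_walk \<Sigma> C"
      using negative_cycle[OF C _ sC] C C'(2) by (auto simp: unbalanced_cycle_walk_def closed_walk_def)
    then have "?S C - u \<in> doubles"
      using coset walk_sum_mod_doubles_coset by blast
    ultimately show ?thesis
      using doubles_add[of "?S W - ?S C" "?S C - u"] by simp
  qed
qed

end

section \<open>Components\<close>

context finite_signed_graph
begin

lemma equiv_reachable: "equiv (verts \<Sigma>) {(u, v). \<exists>W. walk \<Sigma> u W v}"
proof (rule equivI)
  show "{(u, v). \<exists>W. walk \<Sigma> u W v} \<subseteq> verts \<Sigma> \<times> verts \<Sigma>"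
    using walk_verts by blast
  show "refl_on (verts \<Sigma>) {(u, v). \<exists>W. walk \<Sigma> u W v}"
    by (rule refl_onI) (auto intro: exI[of _ "[]"])
  show "sym {(u, v). \<exists>W. walk \<Sigma> u W v}"
    by (rule symI) (use walk_rev in blast)
  show "trans {(u, v). \<exists>W. walk \<Sigma> u W v}"
  proof (rule transI)
    fix a b c assume "(a, b) \<in> {(u, v). \<exists>W. walk \<Sigma> u W v}" "(b, c) \<in> {(u, v). \<exists>W. walk \<Sigma> u W v}"
    then obtain U V where "walk \<Sigma> a U b" "walk \<Sigma> b V c"
      by auto
    then have "walk \<Sigma> a (U @ V) c"
      unfolding walk_append by blast
    then show "(a, c) \<in> {(u, v). \<exists>W. walk \<Sigma> u W v}"
      by blast
  qed
qed

definition component_of :: "'v \<Rightarrow> 'v set" where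
  "component_of v = {w. \<exists>W. walk \<Sigma> v W w}"

lemma components_eq: "components \<Sigma> = component_of ` verts \<Sigma>"
  by (auto simp: components_def quotient_def component_of_def)

lemma component_of_walk: "walk \<Sigma> a W b \<Longrightarrow> component_of a = component_of b"
  using equiv_class_eq[OF equiv_reachable, of a b] by (auto simp: component_of_def Image_def)

lemma component_of_self: "v \<in> verts \<Sigma> \<Longrightarrow> v \<in> component_of v"
  by (auto simp: component_of_def intro: exI[of _ "[]"])

text \<open>An arbitrary base point of the component, at which potentials are prescribed.\<close>

definition comp_root :: "'v set \<Rightarrow> 'v" where
  "comp_root U = (SOME r. r \<in> U)"

lemma root_in: "U \<in> components \<Sigma> \<Longrightarrow> comp_root U \<in> U"
  using component_of_self by (auto simp: components_eq comp_root_def some_in_eq)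

lemma component_of_root:
  assumes "U \<in> components \<Sigma>"
  shows "comp_root U \<in> verts \<Sigma>" "component_of (comp_root U) = U"
proof -
  obtain v where v: "U = component_of v"
    using assms by (auto simp: components_eq)
  then obtain W where W: "walk \<Sigma> v W (comp_root U)"
    using root_in[OF assms] unfolding component_of_def by blast
  show "comp_root U \<in> verts \<Sigma>"
    using walk_verts(2)[OF W] .
  show "component_of (comp_root U) = U"
    using component_of_walk[OF W] v by (rule trans[OF sym sym])
qed

text \<open>These fixed walks to the base point do the work of a spanning tree. The walk chosen at
  the base point itself may be nonempty.\<close>

definition root_walk :: "'v \<Rightarrow> ('e \<times> bool) list" where
  "root_walk v = (SOME W. walk \<Sigma> v W (comp_root (component_of v)))"

lemma root_walk: "v \<in> verts \<Sigma> \<Longrightarrow> walk \<Sigma> v (root_walk v) (comp_root (component_of v))"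
proof -
  assume "v \<in> verts \<Sigma>"
  then have "comp_root (component_of v) \<in> component_of v"
    using root_in by (simp add: components_eq)
  then have "\<exists>W. walk \<Sigma> v W (comp_root (component_of v))"
    by (simp add: component_of_def)
  then show ?thesis
    unfolding root_walk_def by (rule someI_ex)
qed

text \<open>The last walk plays the part of the fundamental cycle of \<open>h\<close>: conditions on
  closed walks at the root pass through it to single edges.\<close>

lemma root_walk_edge:
  assumes "fst h \<in> edges \<Sigma>"
  defines "r \<equiv> comp_root (component_of (tail \<Sigma> h))"
  shows "component_of (head \<Sigma> h) = component_of (tail \<Sigma> h)"
    and "walk \<Sigma> (tail \<Sigma> h) (root_walk (tail \<Sigma> h)) r"
    and "walk \<Sigma> (head \<Sigma> h) (root_walk (head \<Sigma> h)) r"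
    and "walk \<Sigma> (tail \<Sigma> h) [h] (head \<Sigma> h)"
    and "walk \<Sigma> r (rev_walk (root_walk (tail \<Sigma> h)) @ [h] @ root_walk (head \<Sigma> h)) r"
proof -
  show h: "walk \<Sigma> (tail \<Sigma> h) [h] (head \<Sigma> h)"
    using assms head_verts by simp
  then show c: "component_of (head \<Sigma> h) = component_of (tail \<Sigma> h)"
    using component_of_walk by metis
  show t: "walk \<Sigma> (tail \<Sigma> h) (root_walk (tail \<Sigma> h)) r"
    using root_walk[OF tail_verts[OF assms(1)]] by (simp add: r_def)
  show hd: "walk \<Sigma> (head \<Sigma> h) (root_walk (head \<Sigma> h)) r"
    using root_walk[OF head_verts[OF assms(1)]] by (simp add: r_def c)
  show "walk \<Sigma> r (rev_walk (root_walk (tail \<Sigma> h)) @ [h] @ root_walk (head \<Sigma> h)) r"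
    unfolding walk_append using walk_rev[OF t] h hd by blast
qed

text \<open>Cut out first-return walks as long as they are positive; the total sign forces a
  negative one to appear.\<close>

lemma negative_closed_walk_contains_cycle:
  assumes "walk \<Sigma> v W v" "walk_sign \<Sigma> W = -1"
  shows "\<exists>Q w C. walk \<Sigma> v Q w \<and> walk \<Sigma> w C w \<and> distinct (map (tail \<Sigma>) C) \<and> walk_sign \<Sigma> C = -1"
  using assms
proof (induction "length W" arbitrary: v W rule: less_induct)
  case less
  have "W \<noteq> []"
    using less(3) by auto
  then obtain Q C R w where W: "W = Q @ C @ R" and Q: "walk \<Sigma> v Q w" and C: "walk \<Sigma> w C w"
    and R: "walk \<Sigma> w R v" and C': "C \<noteq> []" "distinct (map (tail \<Sigma>) (Q @ C))"
    using first_return[OF less(2)] by metis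
  have QR: "walk \<Sigma> v (Q @ R) v"
    unfolding walk_append using Q R by blast
  show ?case
  proof (cases "walk_sign \<Sigma> C = 1")
    case True
    have "length (Q @ R) < length W" "walk_sign \<Sigma> (Q @ R) = -1"
      using less(3) True C'(1) by (simp_all add: W)
    then show ?thesis
      using less(1)[OF _ QR] by blast
  next
    case False
    then have "walk_sign \<Sigma> C = -1" "distinct (map (tail \<Sigma>) C)"
      using walk_sign_cases[OF C] C'(2) by simp_all
    then show ?thesis
      using Q C by blast
  qed
qed

text \<open>An edge at a vertex of a component has its other end there too, so no walk leaves the
  component.\<close>

lemma walk_induced:
  assumes "U \<in> components \<Sigma>" "a \<in> U"
  shows "walk (induced_subgraph \<Sigma> U) a W b \<longleftrightarrow> walk \<Sigma> a W b"
  using assms(2)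
proof (induction W arbitrary: a)
  case Nil
  then have "a \<in> verts \<Sigma>"
    using assms(1) walk_verts by (auto simp: components_eq component_of_def)
  then show ?case
    using Nil by (auto simp: induced_subgraph_def)
next
  case (Cons h W)
  show ?case
  proof (cases "fst h \<in> edges \<Sigma> \<and> tail \<Sigma> h = a")
    case True
    then have "walk \<Sigma> a [h] (head \<Sigma> h)"
      using head_verts by simp
    moreover obtain v where v: "U = component_of v"
      using assms(1) by (auto simp: components_eq)
    then obtain V where "walk \<Sigma> v V a"
      using Cons.prems by (auto simp: component_of_def)
    ultimately have "walk \<Sigma> v (V @ [h]) (head \<Sigma> h)"
      unfolding walk_append by blast
    then have hd: "head \<Sigma> h \<in> U"
      by (auto simp: v component_of_def simp del: walk_append)
    have "attach \<Sigma> (fst h, b) \<in> {tail \<Sigma> h, head \<Sigma> h}" for b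
      by (cases h; cases "b = snd h") (auto simp: tail_def head_def)
    then have "attach \<Sigma> (fst h, b) \<in> U" for b
      using hd True Cons.prems by (metis insertE singletonD)
    then have "fst h \<in> edges (induced_subgraph \<Sigma> U)"
      using True by (simp add: induced_subgraph_def)
    then show ?thesis
      using True Cons.IH[OF hd] by (simp add: tail_def head_def induced_subgraph_def)
  next
    case False
    then show ?thesis
      by (auto simp: induced_subgraph_def tail_def)
  qed
qed

text \<open>Trades cycles for closed walks at one vertex: a negative closed walk contains an
  unbalanced cycle, and conversely joining a cycle to the root by a walk and its reverse preserves
  the sign.\<close>

lemma balanced_component_iff:
  assumes U: "U \<in> components \<Sigma>"
  shows "balanced (induced_subgraph \<Sigma> U) \<longleftrightarrow>
    (\<forall>W. walk \<Sigma> (comp_root U) W (comp_root U) \<longrightarrow> walk_sign \<Sigma> W = 1)"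
proof
  assume bal: "balanced (induced_subgraph \<Sigma> U)"
  show "\<forall>W. walk \<Sigma> (comp_root U) W (comp_root U) \<longrightarrow> walk_sign \<Sigma> W = 1"
  proof (intro allI impI, rule ccontr)
    fix W assume W: "walk \<Sigma> (comp_root U) W (comp_root U)" "walk_sign \<Sigma> W \<noteq> 1"
    then have "walk_sign \<Sigma> W = -1"
      using walk_sign_cases by blast
    with W(1) obtain Q w C where Q: "walk \<Sigma> (comp_root U) Q w" and C: "walk \<Sigma> w C w"
      "distinct (map (tail \<Sigma>) C)" "walk_sign \<Sigma> C = -1"
      using negative_closed_walk_contains_cycle by metis
    have "w \<in> U"
      using Q component_of_root[OF U] by (auto simp: component_of_def)
    then have "closed_walk (induced_subgraph \<Sigma> U) C"
      using C(1) walk_induced[OF U] by (auto simp: closed_walk_def)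
    moreover have "C \<noteq> []"
      using C(3) by auto
    ultimately have "cycle (induced_subgraph \<Sigma> U) (set (edge_list C))"
      using C(2) negative_cycle(1)[OF C] unfolding cycle_def
      by (intro exI[of _ C]) (simp add: tail_def[abs_def] induced_subgraph_def)
    then have "(\<Prod>e\<in>set (edge_list C). esign \<Sigma> e) = 1"
      using bal by (simp add: balanced_def balanced_cycle_def induced_subgraph_def)
    then show False
      using walk_sign_eq_prod[OF negative_cycle(1)[OF C], of \<Sigma>] C(3) by simp
  qed
next
  assume pos: "\<forall>W. walk \<Sigma> (comp_root U) W (comp_root U) \<longrightarrow> walk_sign \<Sigma> W = 1"
  show "balanced (induced_subgraph \<Sigma> U)"
    unfolding balanced_def balanced_cycle_def
  proof (intro allI impI conjI)
    fix C assume C: "cycle (induced_subgraph \<Sigma> U) C"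
    then obtain v W where W: "walk (induced_subgraph \<Sigma> U) v W v" "W \<noteq> []" "distinct (edge_list W)"
      "set (edge_list W) = C"
      by (auto simp: cycle_def closed_walk_def)
    then have v: "v \<in> U"
      by (cases W) (auto simp: induced_subgraph_def tail_def)
    then have W': "walk \<Sigma> v W v"
      using W(1) walk_induced[OF U] by blast
    obtain Q where Q: "walk \<Sigma> (comp_root U) Q v"
      using v component_of_root[OF U] by (auto simp: component_of_def)
    have "walk \<Sigma> (comp_root U) (Q @ W @ rev_walk Q) (comp_root U)"
      unfolding walk_append using Q W' walk_rev[OF Q] by blast
    then have "walk_sign \<Sigma> (Q @ W @ rev_walk Q) = 1"
      using pos by blast
    then have "walk_sign \<Sigma> W = 1"
      using walk_sign_cases[OF Q] by auto
    then show "prod (esign (induced_subgraph \<Sigma> U)) C = 1"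
      using walk_sign_eq_prod[OF W(3), of \<Sigma>] W(4) by (simp add: induced_subgraph_def)
  qed auto
qed

end

section \<open>Potentials\<close>

text \<open>
  For a group element \<open>w\<close> with \<open>w + w = u\<close>, this is the action of the sign \<open>s\<close> on \<open>x + w\<close>,
  written in terms of \<open>x\<close>. It makes sense also if \<open>u\<close> is not a double.
\<close>

definition flip :: "'g::ab_group_add \<Rightarrow> int \<Rightarrow> 'g \<Rightarrow> 'g" where
  "flip u s x = (if s = 1 then x else - x - u)"

lemma flip_simps [simp]: "flip u 1 x = x" "flip u (-1) x = - x - u"
  by (auto simp: flip_def)

text \<open>The value on \<open>e\<close> for which the one-step walk by \<open>(e, False)\<close>
  has as its sum the transported end value minus the start value. For a compatible orientation
  \<open>(e, True)\<close> yields the same value.\<close>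

definition delta ::
    "('v, 'e) signed_graph \<Rightarrow> ('e \<times> bool \<Rightarrow> int) \<Rightarrow> 'g::ab_group_add \<Rightarrow> ('v \<Rightarrow> 'g) \<Rightarrow> 'e \<Rightarrow> 'g" where
  "delta \<Sigma> \<omega> u p e =
     sign_scale (\<omega> (e, False)) (flip u (esign \<Sigma> e) (p (attach \<Sigma> (e, True))) - p (attach \<Sigma> (e, False)))"

lemma delta_eq_0_iff:
  "delta \<Sigma> \<omega> u p e = 0 \<longleftrightarrow> flip u (esign \<Sigma> e) (p (attach \<Sigma> (e, True))) = p (attach \<Sigma> (e, False))"
  by (auto simp: delta_def sign_scale_def)

text \<open>\<open>delta\<close> is affine in \<open>p\<close> and its linear part does not depend
  on \<open>u\<close>, so its fibres are translates of the kernel at \<open>u = 0\<close>.\<close>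

lemma delta_diff:
  "delta \<Sigma> \<omega> u p e - delta \<Sigma> \<omega> u q e = delta \<Sigma> \<omega> 0 (\<lambda>v. p v - q v) e"
  by (auto simp: delta_def sign_scale_def flip_def)

context oriented_signed_graph
begin

text \<open>The sum telescopes to the two end values.\<close>

lemma walk_sum_delta:
  assumes f: "\<And>e. e \<in> edges \<Sigma> \<Longrightarrow> f e = delta \<Sigma> \<omega> u p e"
  shows "walk \<Sigma> a W b \<Longrightarrow> walk_sum \<Sigma> \<omega> f W = flip u (walk_sign \<Sigma> W) (p b) - p a"
proof (induction W arbitrary: a)
  case (Cons h W)
  then have h: "fst h \<in> edges \<Sigma>" "tail \<Sigma> h = a" and W: "walk \<Sigma> (head \<Sigma> h) W b"
    by auto
  have "sign_scale (\<omega> h) (f (fst h)) = flip u (esign \<Sigma> (fst h)) (p (head \<Sigma> h)) - p a"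
    using esign_cases[OF h(1)] orientation_cases[OF h(1), of False]
      orientation_reverse[OF h(1), of False] h(2)
    using f[OF h(1)] by (cases h; cases "snd h") (auto simp: delta_def head_def tail_def)
  with Cons.IH[OF W] esign_cases[OF h(1)] walk_sign_cases[OF W] show ?case
    by auto
qed simp

text \<open>From right to left the sums telescope. From left to right a value consistent with all
  closed walks is chosen at each root and transported along the root walks.\<close>

lemma coset_tension_iff_delta:
  fixes f :: "'e \<Rightarrow> 'g::ab_group_add"
  shows "tension \<Sigma> \<omega> f \<and>
      (\<forall>W. unbalanced_cycle_walk \<Sigma> W \<longrightarrow> (\<Sum>e\<leftarrow>edge_list W. f e) \<in> (+) u ` doubles) \<longleftrightarrow>
    (\<exists>p\<in>verts \<Sigma> \<rightarrow>\<^sub>E UNIV. \<forall>e\<in>edges \<Sigma>. f e = delta \<Sigma> \<omega> u p e)" (is "?L \<longleftrightarrow> ?R")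
proof
  let ?S = "walk_sum \<Sigma> \<omega> f" and ?s = "walk_sign \<Sigma>"
  assume ?R
  then obtain p where p: "\<And>e. e \<in> edges \<Sigma> \<Longrightarrow> f e = delta \<Sigma> \<omega> u p e"
    by blast
  note sum = walk_sum_delta[OF p]
  have "tension \<Sigma> \<omega> f"
    unfolding tension_iff
  proof (intro allI impI)
    fix W assume W: "circuit_walk \<Sigma> W"
    then obtain v where "walk \<Sigma> v W v"
      using circuit_walk_sign(1) by (auto simp: closed_walk_def)
    then show "?S W = 0"
      using sum circuit_walk_sign(2)[OF W] by simp
  qed
  moreover have "?S W - u \<in> doubles" if W: "unbalanced_cycle_walk \<Sigma> W" for W
  proof -
    obtain v where "walk \<Sigma> v W v"
      using W by (auto simp: unbalanced_cycle_walk_def closed_walk_def)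
    then have "?S W - u = - ((p v + u) + (p v + u))"
      using sum unbalanced_cycle_walk_sign[OF W] by (simp add: algebra_simps)
    then show ?thesis
      using doubles_uminus doubles_double by metis
  qed
  ultimately show ?L
    using walk_sum_mod_doubles_coset by blast
next
  let ?S = "walk_sum \<Sigma> \<omega> f" and ?s = "walk_sign \<Sigma>"
  assume L: ?L
  note pos = tension_positive_closed_walk[OF conjunct1[OF L]]
  have neg: "?S W - u \<in> doubles" if "walk \<Sigma> v W v" "?s W = -1" for v W
    using tension_negative_closed_walk[of f u v W] L that by blast
  have "\<exists>x. \<forall>W. walk \<Sigma> r W r \<longrightarrow> ?S W = flip u (?s W) x - x" for r
  proof (cases "\<exists>W. walk \<Sigma> r W r \<and> ?s W = -1")
    case True
    then obtain W0 where W0: "walk \<Sigma> r W0 r" "?s W0 = -1"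
      by blast
    then obtain y where y: "?S W0 - u = y + y"
      using neg by (auto simp: doubles_def)
    \<comment> \<open>The witness solves \<open>- x - u - x = y + y + u\<close>. All negative closed
      walks at \<open>r\<close> have the same sum, since two of them form a positive one.\<close>
    have "?S W = flip u (?s W) (- y - u) - (- y - u)" if W: "walk \<Sigma> r W r" for W
    proof (cases "?s W = 1")
      case False
      then have s: "?s W = -1"
        using walk_sign_cases[OF W] by blast
      have "walk \<Sigma> r (W0 @ W) r"
        unfolding walk_append using W0 W by blast
      then have "?S (W0 @ W) = 0"
        using pos s W0(2) by simp
      then have "?S W = ?S W0"
        using W0(2) by (simp add: walk_sum_append[OF W0(1)])
      also have "\<dots> = y + y + u"
        using y by (simp add: algebra_simps)
      finally show ?thesis
        using s by (simp add: algebra_simps)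
    qed (use pos[OF W] in simp)
    then show ?thesis
      by blast
  next
    case False
    then have "?s W = 1" if "walk \<Sigma> r W r" for W
      using walk_sign_cases[OF that] that by blast
    \<comment> \<open>Without negative closed walks at \<open>r\<close> both sides vanish for every
      value, so 0 serves as a default.\<close>
    then show ?thesis
      using pos by (intro exI[of _ 0]) simp
  qed
  then obtain x where x: "\<And>r W. walk \<Sigma> r W r \<Longrightarrow> ?S W = flip u (?s W) (x r) - x r"
    by metis
  \<comment> \<open>Telescoping along \<open>root_walk v\<close> forces this value once the value at
    the root is \<open>x\<close>.\<close>
  define p where "p = restrict (\<lambda>v. flip u (?s (root_walk v)) (x (comp_root (component_of v))) - ?S (root_walk v))
    (verts \<Sigma>)"
  have "f e = delta \<Sigma> \<omega> u p e" if e: "e \<in> edges \<Sigma>" for e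
  proof -
    define h where "h = (e, False)"
    have h: "fst h \<in> edges \<Sigma>"
      using e by (simp add: h_def)
    define r where "r = comp_root (component_of (tail \<Sigma> h))"
    define A B where "A = root_walk (tail \<Sigma> h)" and "B = root_walk (head \<Sigma> h)"
    note rw = root_walk_edge[OF h, folded r_def A_def B_def]
    have S: "?S (rev_walk A @ [h] @ B) = flip u (?s (rev_walk A @ [h] @ B)) (x r) - x r"
      using x[OF rw(5)] .
    have p: "p (tail \<Sigma> h) = flip u (?s A) (x r) - ?S A" "p (head \<Sigma> h) = flip u (?s B) (x r) - ?S B"
      using tail_verts[OF h] head_verts[OF h] rw(1) by (simp_all add: p_def r_def A_def B_def)
    have "sign_scale (\<omega> h) (f e) = flip u (esign \<Sigma> e) (p (head \<Sigma> h)) - p (tail \<Sigma> h)"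
      using S walk_sign_cases[OF rw(2)] walk_sign_cases[OF rw(3)] esign_cases[OF e]
      unfolding p walk_sum_append[OF walk_rev[OF rw(2)]] walk_sum_append[OF rw(4)] walk_sum_rev[OF rw(2)]
      by (auto simp: h_def algebra_simps)
    then show ?thesis
      using orientation_cases[OF e, of False]
      by (auto simp: delta_def h_def head_def tail_def algebra_simps)
  qed
  then show ?R
    by (intro bexI[of _ p]) (auto simp: p_def)
qed

end

section \<open>Counting\<close>

context finite_signed_graph
begin

text \<open>The vanishing of \<open>delta\<close> does not involve the orientation, so it is stated
  for a bare signed graph and can be applied to every spanning subgraph.\<close>

definition flat_potentials :: "'g::ab_group_add \<Rightarrow> ('v \<Rightarrow> 'g) set" where
  "flat_potentials u = {p \<in> verts \<Sigma> \<rightarrow>\<^sub>E UNIV. \<forall>e\<in>edges \<Sigma>.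
     flip u (esign \<Sigma> e) (p (attach \<Sigma> (e, True))) = p (attach \<Sigma> (e, False))}"

lemma flat_potential_walk:
  assumes "p \<in> flat_potentials u"
  shows "walk \<Sigma> a W b \<Longrightarrow> p a = flip u (walk_sign \<Sigma> W) (p b)"
proof (induction W arbitrary: a)
  case (Cons h W)
  then have h: "fst h \<in> edges \<Sigma>" "tail \<Sigma> h = a" and W: "walk \<Sigma> (head \<Sigma> h) W b"
    by auto
  have flat: "p (attach \<Sigma> (fst h, False)) = flip u (esign \<Sigma> (fst h)) (p (attach \<Sigma> (fst h, True)))"
    using assms h(1) by (simp add: flat_potentials_def)
  then have "p a = flip u (esign \<Sigma> (fst h)) (p (head \<Sigma> h))"
    using esign_cases[OF h(1)] h(2)
    by (cases h; cases "snd h") (auto simp: head_def tail_def)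
  with Cons.IH[OF W] esign_cases[OF h(1)] walk_sign_cases[OF W] show ?case
    by auto
qed simp

lemma num_comps_eq: "num_comps \<Sigma> = num_bal_comps \<Sigma> + num_unbal_comps \<Sigma>"
proof -
  have "components \<Sigma> = {U \<in> components \<Sigma>. balanced (induced_subgraph \<Sigma> U)} \<union>
      {U \<in> components \<Sigma>. \<not> balanced (induced_subgraph \<Sigma> U)}"
    by auto
  moreover have "finite (components \<Sigma>)"
    using finite_verts by (simp add: components_eq)
  ultimately have "card (components \<Sigma>) = card {U \<in> components \<Sigma>. balanced (induced_subgraph \<Sigma> U)} +
      card {U \<in> components \<Sigma>. \<not> balanced (induced_subgraph \<Sigma> U)}"
    using card_Un_disjoint[of "{U \<in> components \<Sigma>. balanced (induced_subgraph \<Sigma> U)}"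
        "{U \<in> components \<Sigma>. \<not> balanced (induced_subgraph \<Sigma> U)}"] by force
  then show ?thesis
    by (simp only: num_comps_def num_bal_comps_def num_unbal_comps_def)
qed

lemma num_comps_le: "num_comps \<Sigma> \<le> card (verts \<Sigma>)"
  using finite_verts by (simp add: num_comps_def components_eq card_image_le)

text \<open>A flat potential is determined by its values at the roots. A negative closed walk at a
  root forces \<open>x + x = - u\<close> there; in a balanced component every value is
  admissible.\<close>

lemma card_flat_potentials:
  fixes u :: "'g::{ab_group_add, finite}"
  shows "card (flat_potentials u) =
    CARD('g) ^ num_bal_comps \<Sigma> * card {x::'g. x + x = - u} ^ num_unbal_comps \<Sigma>"
proof -
  \<comment> \<open>\<open>T U\<close> is the set of admissible values at the root of
    \<open>U\<close>; \<open>F\<close> reads off the root values, and \<open>H\<close> transports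
    them back along the root walks.\<close>
  define T where "T U = (if balanced (induced_subgraph \<Sigma> U) then UNIV else {x::'g. x + x = - u})" for U
  define F where "F p = restrict (\<lambda>U. p (comp_root U)) (components \<Sigma>)" for p :: "'v \<Rightarrow> 'g"
  define H where "H q = restrict (\<lambda>v. flip u (walk_sign \<Sigma> (root_walk v)) (q (component_of v))) (verts \<Sigma>)"
    for q :: "'v set \<Rightarrow> 'g"
  have comp: "component_of v \<in> components \<Sigma>" if "v \<in> verts \<Sigma>" for v
    using that by (simp add: components_eq)
  have fixed: "flip u (walk_sign \<Sigma> W) x = x"
    if "U \<in> components \<Sigma>" "x \<in> T U" and W: "walk \<Sigma> (comp_root U) W (comp_root U)" for U x W
  proof (cases "walk_sign \<Sigma> W = 1")
    case False
    then have "\<not> balanced (induced_subgraph \<Sigma> U)" "walk_sign \<Sigma> W = -1"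
      using balanced_component_iff[OF that(1)] W walk_sign_cases[OF W] by auto
    moreover from this have "- x - u = - x + (x + x)"
      using that(2) by (simp add: T_def)
    ultimately show ?thesis
      by simp
  qed simp
  have "bij_betw F (flat_potentials u) (PiE (components \<Sigma>) T)"
  proof (rule bij_betw_byWitness[where f' = H])
    show "\<forall>p\<in>flat_potentials u. H (F p) = p"
    proof
      fix p assume p: "p \<in> flat_potentials u"
      then have ext: "p \<in> extensional (verts \<Sigma>)"
        by (auto simp: flat_potentials_def PiE_def)
      show "H (F p) = p"
      proof (rule extensionalityI[OF _ ext])
        fix v assume "v \<in> verts \<Sigma>"
        then show "H (F p) v = p v"
          using flat_potential_walk[OF p root_walk] comp by (simp add: H_def F_def)
      qed (simp add: H_def)
    qed
    show "F ` flat_potentials u \<subseteq> PiE (components \<Sigma>) T"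
    proof (clarify, intro PiE_I)
      fix p U assume p: "p \<in> flat_potentials u" and U: "U \<in> components \<Sigma>"
      have "p (comp_root U) + p (comp_root U) = - u" if unbal: "\<not> balanced (induced_subgraph \<Sigma> U)"
      proof -
        obtain W where W: "walk \<Sigma> (comp_root U) W (comp_root U)" "walk_sign \<Sigma> W = -1"
          using unbal balanced_component_iff[OF U] walk_sign_cases by blast
        have "p (comp_root U) = - p (comp_root U) - u"
          using flat_potential_walk[OF p W(1)] unfolding W(2) flip_simps .
        then have "p (comp_root U) + p (comp_root U) = p (comp_root U) + (- p (comp_root U) - u)"
          by (rule arg_cong)
        then show ?thesis
          by simp
      qed
      then show "F p U \<in> T U"
        using U by (simp add: F_def T_def)
    qed (simp add: F_def)
    show "\<forall>q\<in>PiE (components \<Sigma>) T. F (H q) = q"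
    proof
      fix q assume q: "q \<in> PiE (components \<Sigma>) T"
      show "F (H q) = q"
      proof (rule extensionalityI)
        fix U assume U: "U \<in> components \<Sigma>"
        note r = component_of_root[OF U]
        \<comment> \<open>The root walk of the root may be a nontrivial closed walk; admissible
          values are fixed by its flip.\<close>
        have W: "walk \<Sigma> (comp_root U) (root_walk (comp_root U)) (comp_root U)"
          using root_walk[OF r(1)] r(2) by simp
        have "q U \<in> T U"
          using q U by auto
        then have "flip u (walk_sign \<Sigma> (root_walk (comp_root U))) (q U) = q U"
          using fixed[OF U _ W] by blast
        then show "F (H q) U = q U"
          using U r by (simp add: F_def H_def)
      qed (use q in \<open>auto simp: F_def PiE_def\<close>)
    qed
    show "H ` PiE (components \<Sigma>) T \<subseteq> flat_potentials u"
    proof clarify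
      fix q assume q: "q \<in> PiE (components \<Sigma>) T"
      have "flip u (esign \<Sigma> e) (H q (attach \<Sigma> (e, True))) = H q (attach \<Sigma> (e, False))"
        if e: "e \<in> edges \<Sigma>" for e
      proof -
        define h where "h = (e, False)"
        have h: "fst h \<in> edges \<Sigma>"
          using e by (simp add: h_def)
        define U where "U = component_of (tail \<Sigma> h)"
        define A B where "A = root_walk (tail \<Sigma> h)" and "B = root_walk (head \<Sigma> h)"
        note rw = root_walk_edge[OF h, folded A_def B_def U_def]
        have U: "U \<in> components \<Sigma>"
          using comp[OF tail_verts[OF h]] by (simp add: U_def)
        have "q U \<in> T U"
          using q U by auto
        then have "flip u (walk_sign \<Sigma> (rev_walk A @ [h] @ B)) (q U) = q U"
          using fixed[OF U _ rw(5)] by blast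
        then have "flip u (esign \<Sigma> e) (flip u (walk_sign \<Sigma> B) (q U)) = flip u (walk_sign \<Sigma> A) (q U)"
          using walk_sign_cases[OF rw(2)] walk_sign_cases[OF rw(3)] esign_cases[OF e]
          by (auto simp: h_def algebra_simps)
        moreover have "H q (tail \<Sigma> h) = flip u (walk_sign \<Sigma> A) (q U)"
          "H q (head \<Sigma> h) = flip u (walk_sign \<Sigma> B) (q U)"
          using tail_verts[OF h] head_verts[OF h] rw(1) by (simp_all add: H_def U_def A_def B_def)
        ultimately show ?thesis
          by (simp add: h_def head_def tail_def)
      qed
      then show "H q \<in> flat_potentials u"
        by (auto simp: flat_potentials_def H_def)
    qed
  qed
  then have "card (flat_potentials u) = (\<Prod>U\<in>components \<Sigma>. card (T U))"
    using finite_verts by (simp add: bij_betw_same_card card_PiE components_eq)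
  also have "\<dots> = (\<Prod>U\<in>components \<Sigma>. if balanced (induced_subgraph \<Sigma> U) then CARD('g)
      else card {x::'g. x + x = - u})"
    by (intro prod.cong) (auto simp: T_def)
  also have "\<dots> = CARD('g) ^ num_bal_comps \<Sigma> * card {x::'g. x + x = - u} ^ num_unbal_comps \<Sigma>"
  proof -
    have "finite (components \<Sigma>)"
      using finite_verts by (simp add: components_eq)
    moreover have "components \<Sigma> \<inter> {U. balanced (induced_subgraph \<Sigma> U)} =
        {U \<in> components \<Sigma>. balanced (induced_subgraph \<Sigma> U)}"
      "components \<Sigma> \<inter> - {U. balanced (induced_subgraph \<Sigma> U)} =
        {U \<in> components \<Sigma>. \<not> balanced (induced_subgraph \<Sigma> U)}"
      by blast+
    ultimately show ?thesis
      by (simp add: prod.If_cases num_bal_comps_def num_unbal_comps_def)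
  qed
  finally show ?thesis .
qed

end

section \<open>Inclusion-exclusion, the doubling map and the terms of the Tutte polynomial\<close>

text \<open>The indicator of avoiding every \<open>Z p e\<close> is a product of factors
  \<open>1 - of_bool (Z p e)\<close>, which is expanded over the subsets of
  \<open>E\<close>.\<close>

lemma inclusion_exclusion_avoiding:
  assumes "finite P" "finite E"
  shows "real (card {p \<in> P. \<forall>e\<in>E. \<not> Z p e}) =
    (\<Sum>A\<in>Pow E. (-1) ^ card A * real (card {p \<in> P. \<forall>e\<in>A. Z p e}))"
proof -
  have bool: "(\<Prod>e\<in>A. of_bool (Q e)) = (of_bool (\<forall>e\<in>A. Q e) :: real)" if "finite A" for A and Q :: "'b \<Rightarrow> bool"
    using that by induction auto
  have "real (card {p \<in> P. \<forall>e\<in>E. \<not> Z p e}) = (\<Sum>p\<in>P. of_bool (\<forall>e\<in>E. \<not> Z p e))"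
    using assms(1) by (simp add: of_bool_def sum.If_cases Int_def)
  also have "\<dots> = (\<Sum>p\<in>P. \<Prod>e\<in>E. 1 - of_bool (Z p e))"
    by (intro sum.cong refl) (simp add: assms(2) flip: bool of_bool_not_iff)
  also have "\<dots> = (\<Sum>p\<in>P. \<Sum>A\<in>Pow E. (-1) ^ card A * of_bool (\<forall>e\<in>A. Z p e))"
    using assms(2) finite_subset[OF _ assms(2)] by (simp add: prod_diff_conv_sum bool)
  also have "\<dots> = (\<Sum>A\<in>Pow E. (-1) ^ card A * (\<Sum>p\<in>P. of_bool (\<forall>e\<in>A. Z p e)))"
    by (subst sum.swap) (simp add: sum_distrib_left)
  also have "\<dots> = (\<Sum>A\<in>Pow E. (-1) ^ card A * real (card {p \<in> P. \<forall>e\<in>A. Z p e}))"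
    using assms(1) by (simp add: of_bool_def sum.If_cases Int_def)
  finally show ?thesis .
qed

text \<open>Translation by a half of \<open>y\<close> maps the fibre of doubling over 0 onto the
  fibre over \<open>y\<close>.\<close>

lemma card_double_fibre:
  fixes y :: "'g::{ab_group_add, finite}"
  assumes "y \<in> doubles"
  shows "card {x. x + x = y} = card {x::'g. x + x = 0}"
proof -
  obtain a where a: "y = a + a"
    using assms by (auto simp: doubles_def)
  have *: "(x + a) + (x + a) = (x + x) + y" "(x - a) + (x - a) = (x + x) - y" for x
    by (simp_all add: a algebra_simps)
  have "bij_betw (\<lambda>x. x + a) {x. x + x = 0} {x. x + x = y}"
    by (rule bij_betw_byWitness[where f' = "\<lambda>x. x - a"]) (simp_all add: image_subset_iff *)
  from bij_betw_same_card[OF this] show ?thesis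
    by (rule sym)
qed

text \<open>The group is partitioned into the fibres of doubling, which all have the same
  size.\<close>

lemma card_two_torsion_doubles:
  "card {x::'g::{ab_group_add, finite}. x + x = 0} * card (doubles :: 'g set) = CARD('g)"
proof -
  have "CARD('g) = (\<Sum>y\<in>doubles. card {x \<in> UNIV. x + x = (y::'g)})"
    using sum.group[of "UNIV :: 'g set" doubles "\<lambda>x. x + x" "\<lambda>_. 1::nat"]
    by (simp add: image_subsetI doubles_double)
  also have "\<dots> = (\<Sum>y\<in>(doubles :: 'g set). card {x::'g. x + x = 0})"
    by (intro sum.cong refl) (simp add: card_double_fibre)
  finally show ?thesis
    by (simp add: mult.commute)
qed

lemma card_doubles_pos: "card (doubles :: 'g::{ab_group_add, finite} set) > 0"
  using doubles_0[where 'a = 'g] by (auto simp: card_gt_0_iff)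

lemma card_two_torsion:
  "real (card {x::'g::{ab_group_add, finite}. x + x = 0}) = real CARD('g) / real (card (doubles :: 'g set))"
proof -
  have "real (card (doubles :: 'g set)) \<noteq> 0"
    using card_doubles_pos[where 'g = 'g] by linarith
  then show ?thesis
    using arg_cong[OF card_two_torsion_doubles[where 'g = 'g], of real]
    unfolding of_nat_mult by (rule iffD2[OF nonzero_eq_divide_eq])
qed

text \<open>Matches one Tutte term with one inclusion-exclusion term. \<open>n\<close> and
  \<open>d\<close> stand for the orders of the group and of its doubles; \<open>b\<close>,
  \<open>c\<close> count the balanced and unbalanced components of the graph and \<open>b'\<close>,
  \<open>c'\<close> those of the subgraph with \<open>a\<close> edges.\<close>

lemma tutte_term_eq:
  fixes n d z :: real and a V b c b' c' :: nat
  assumes "n > 0" "d > 0" "b + c \<le> V"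
  shows "(-1) ^ (V - (b + c)) * d ^ c *
      ((- n) powi (int (b' + c') - int (b + c)) * (-1) powi (int a - int V + int b') * (- z) ^ c') *
      (n ^ b * (n / d) ^ c) = (-1) ^ a * (n ^ b' * (n * z) ^ c')"
proof -
  have 1: "(- n) powi (int (b' + c') - int (b + c)) = (-1) ^ (b' + c' + (b + c)) * (n ^ (b' + c') / n ^ (b + c))"
  proof -
    have "(- n) powi (int (b' + c') - int (b + c)) = (- n) ^ (b' + c') / (- n) ^ (b + c)"
      using assms(1) by (subst power_int_diff) (simp_all del: of_nat_add)
    also have "\<dots> = (-1) ^ (b' + c') / (-1) ^ (b + c) * (n ^ (b' + c') / n ^ (b + c))"
      by (subst (1 2) power_minus) simp
    finally show ?thesis
      by (cases "even (b + c)") (simp_all add: power_add[of _ "b' + c'"])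
  qed
  have 2: "(-1 :: real) powi (int a - int V + int b') = (-1) ^ (a + V + b')"
    by (cases "even V") (simp_all add: power_int_add power_int_diff power_add)
  have 3: "(- z) ^ c' = (-1) ^ c' * z ^ c'"
    by (subst power_minus) simp
  have "(-1 :: real) ^ (V - (b + c)) * (-1) ^ (b' + c' + (b + c)) * (-1) ^ (a + V + b') * (-1) ^ c' =
      (-1) ^ (V - (b + c) + (b' + c' + (b + c)) + (a + V + b') + c')"
    by (simp add: power_add)
  \<comment> \<open>The exponents of -1 add up to \<open>a\<close> plus an even number; the
    truncated subtraction is exact because \<open>b + c \<le> V\<close>.\<close>
  also have "V - (b + c) + (b' + c' + (b + c)) + (a + V + b') + c' = a + 2 * (V + b' + c')"
    using assms(3) by simp
  finally have sign: "(-1 :: real) ^ (V - (b + c)) * (-1) ^ (b' + c' + (b + c)) * (-1) ^ (a + V + b') * (-1) ^ c'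
      = (-1) ^ a"
    by (simp add: power_add power_mult)
  have size: "d ^ c * (n ^ (b' + c') / n ^ (b + c)) * z ^ c' * (n ^ b * (n / d) ^ c) = n ^ b' * (n * z) ^ c'"
    using assms(1,2) by (simp add: power_add power_divide power_mult_distrib field_simps)
  show ?thesis
    unfolding 1 2 3 sign[symmetric] size[symmetric] by (simp add: mult_ac)
qed

lemma finite_signed_graph_spanning:
  assumes "finite_signed_graph \<Sigma>" "A \<subseteq> edges \<Sigma>"
  shows "finite_signed_graph (spanning_subgraph \<Sigma> A)"
  using assms finite_subset[of A "edges \<Sigma>"]
  by (auto simp: finite_signed_graph_def signed_graph_def spanning_subgraph_def)

section \<open>Counting the tensions with cycle sums in a given coset\<close>

context oriented_signed_graph
begin

text \<open>Vanishing on \<open>A\<close> is flatness on the spanning subgraph with edge set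
  \<open>A\<close>.\<close>

lemma card_delta_zero_on:
  fixes u :: "'g::{ab_group_add, finite}"
  assumes "A \<subseteq> edges \<Sigma>"
  shows "card {p \<in> verts \<Sigma> \<rightarrow>\<^sub>E UNIV. \<forall>e\<in>A. delta \<Sigma> \<omega> u p e = 0} =
    CARD('g) ^ num_bal_comps (spanning_subgraph \<Sigma> A) *
    card {x::'g. x + x = - u} ^ num_unbal_comps (spanning_subgraph \<Sigma> A)"
proof -
  interpret A: finite_signed_graph "spanning_subgraph \<Sigma> A"
    using finite_signed_graph_spanning[OF _ assms] finite_signed_graph_axioms by blast
  have "A.flat_potentials u = {p \<in> verts \<Sigma> \<rightarrow>\<^sub>E UNIV. \<forall>e\<in>A. delta \<Sigma> \<omega> u p e = 0}"
    unfolding A.flat_potentials_def delta_eq_0_iff by (simp add: spanning_subgraph_def)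
  then show ?thesis
    using A.card_flat_potentials[of u] by simp
qed

lemma nz_tensions_coset_eq:
  "nz_tensions_coset \<Sigma> \<omega> u =
    (\<lambda>p. restrict (delta \<Sigma> \<omega> u p) (edges \<Sigma>)) `
      {p \<in> verts \<Sigma> \<rightarrow>\<^sub>E UNIV. \<forall>e\<in>edges \<Sigma>. delta \<Sigma> \<omega> u p e \<noteq> 0}" (is "?N = ?F ` ?P")
proof
  show "?N \<subseteq> ?F ` ?P"
  proof
    fix f assume f: "f \<in> ?N"
    then have "tension \<Sigma> \<omega> f \<and>
        (\<forall>W. unbalanced_cycle_walk \<Sigma> W \<longrightarrow> (\<Sum>e\<leftarrow>edge_list W. f e) \<in> (+) u ` doubles)"
      by (simp add: nz_tensions_coset_def nz_tensions_def)
    then obtain p where p: "p \<in> verts \<Sigma> \<rightarrow>\<^sub>E UNIV" "\<forall>e\<in>edges \<Sigma>. f e = delta \<Sigma> \<omega> u p e"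
      unfolding coset_tension_iff_delta by blast
    have "f = ?F p"
      by (rule extensionalityI[of _ "edges \<Sigma>"])
        (use f p(2) in \<open>auto simp: nz_tensions_coset_def nz_tensions_def PiE_def\<close>)
    moreover have "p \<in> ?P"
      using f p by (auto simp: nz_tensions_coset_def nz_tensions_def nowhere_zero_def)
    ultimately show "f \<in> ?F ` ?P"
      by blast
  qed
  show "?F ` ?P \<subseteq> ?N"
  proof clarify
    fix p assume p: "p \<in> verts \<Sigma> \<rightarrow>\<^sub>E UNIV" "\<forall>e\<in>edges \<Sigma>. delta \<Sigma> \<omega> u p e \<noteq> 0"
    have "tension \<Sigma> \<omega> (?F p) \<and>
        (\<forall>W. unbalanced_cycle_walk \<Sigma> W \<longrightarrow> (\<Sum>e\<leftarrow>edge_list W. ?F p e) \<in> (+) u ` doubles)"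
      unfolding coset_tension_iff_delta using p(1) by (intro bexI[of _ p]) auto
    then show "?F p \<in> ?N"
      using p(2) unfolding nz_tensions_coset_def nz_tensions_def nowhere_zero_def mem_Collect_eq
      by (intro conjI; (blast | simp))
  qed
qed

text \<open>Subtracting a fixed potential \<open>q\<close> maps its fibre bijectively onto the
  kernel at \<open>u = 0\<close>; being nowhere zero depends only on the fibre.\<close>

lemma card_nz_tensions_coset:
  fixes u :: "'g::{ab_group_add, finite}"
  shows "card (nz_tensions_coset \<Sigma> \<omega> u) *
      card {k \<in> verts \<Sigma> \<rightarrow>\<^sub>E UNIV. \<forall>e\<in>edges \<Sigma>. delta \<Sigma> \<omega> (0::'g) k e = 0} =
    card {p \<in> verts \<Sigma> \<rightarrow>\<^sub>E UNIV. \<forall>e\<in>edges \<Sigma>. delta \<Sigma> \<omega> u p e \<noteq> 0}"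
    (is "_ * card ?K = card ?P")
proof -
  let ?F = "\<lambda>p. restrict (delta \<Sigma> \<omega> u p) (edges \<Sigma>)"
  have fin: "finite ?P"
    by (rule finite_subset[of _ "verts \<Sigma> \<rightarrow>\<^sub>E UNIV"]) (auto intro: finite_PiE finite_verts)
  have fibre: "card {p \<in> ?P. ?F p = f} = card ?K" if f: "f \<in> ?F ` ?P" for f
  proof -
    obtain q where q: "q \<in> ?P" "f = ?F q"
      using f by (rule imageE)
    have delta_iff: "?F p = f \<longleftrightarrow> (\<forall>e\<in>edges \<Sigma>. delta \<Sigma> \<omega> 0 (\<lambda>v. p v - q v) e = 0)" for p
    proof -
      have "?F p = f \<longleftrightarrow> (\<forall>e\<in>edges \<Sigma>. delta \<Sigma> \<omega> u p e = delta \<Sigma> \<omega> u q e)"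
      proof
        assume "?F p = f"
        then have "?F p e = ?F q e" for e
          by (simp only: q(2))
        then show "\<forall>e\<in>edges \<Sigma>. delta \<Sigma> \<omega> u p e = delta \<Sigma> \<omega> u q e"
          by (metis restrict_apply')
      next
        assume "\<forall>e\<in>edges \<Sigma>. delta \<Sigma> \<omega> u p e = delta \<Sigma> \<omega> u q e"
        then show "?F p = f"
          unfolding q(2) by (intro restrict_ext) blast
      qed
      then show ?thesis
        unfolding delta_diff[of \<Sigma> \<omega> u p _ q, symmetric] by simp
    qed
    \<comment> \<open>Differences of potentials are restricted to the vertices to stay extensional;
      \<open>delta\<close> on an edge reads only values at vertices.\<close>
    have delta_cong: "delta \<Sigma> \<omega> w p e = delta \<Sigma> \<omega> w p' e"
      if "\<And>v. v \<in> verts \<Sigma> \<Longrightarrow> p v = p' v" "e \<in> edges \<Sigma>" for w p p' e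
      using that attach_verts[OF that(2)] by (simp add: delta_def)
    have "bij_betw (\<lambda>p. restrict (\<lambda>v. p v - q v) (verts \<Sigma>)) {p \<in> ?P. ?F p = f} ?K"
    proof (rule bij_betw_byWitness[where f' = "\<lambda>k. restrict (\<lambda>v. k v + q v) (verts \<Sigma>)"])
      show "\<forall>p\<in>{p \<in> ?P. ?F p = f}. restrict (\<lambda>v. restrict (\<lambda>v. p v - q v) (verts \<Sigma>) v + q v) (verts \<Sigma>) = p"
        by (intro ballI extensionalityI[of _ "verts \<Sigma>"]) (simp_all add: PiE_def)
      show "\<forall>k\<in>?K. restrict (\<lambda>v. restrict (\<lambda>v. k v + q v) (verts \<Sigma>) v - q v) (verts \<Sigma>) = k"
        by (intro ballI extensionalityI[of _ "verts \<Sigma>"]) (simp_all add: PiE_def)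
      show "(\<lambda>p. restrict (\<lambda>v. p v - q v) (verts \<Sigma>)) ` {p \<in> ?P. ?F p = f} \<subseteq> ?K"
      proof (rule image_subsetI)
        fix p assume "p \<in> {p \<in> ?P. ?F p = f}"
        then have "\<forall>e\<in>edges \<Sigma>. delta \<Sigma> \<omega> 0 (\<lambda>v. p v - q v) e = 0"
          using delta_iff by blast
        then show "restrict (\<lambda>v. p v - q v) (verts \<Sigma>) \<in> ?K"
          using delta_cong[of "restrict (\<lambda>v. p v - q v) (verts \<Sigma>)" "\<lambda>v. p v - q v" _ 0] by simp
      qed
      show "(\<lambda>k. restrict (\<lambda>v. k v + q v) (verts \<Sigma>)) ` ?K \<subseteq> {p \<in> ?P. ?F p = f}"
      proof
        fix p assume "p \<in> (\<lambda>k. restrict (\<lambda>v. k v + q v) (verts \<Sigma>)) ` ?K"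
        then obtain k where k: "k \<in> ?K" "p = restrict (\<lambda>v. k v + q v) (verts \<Sigma>)"
          by blast
        have "delta \<Sigma> \<omega> 0 (\<lambda>v. p v - q v) e = delta \<Sigma> \<omega> 0 k e" if "e \<in> edges \<Sigma>" for e
          by (rule delta_cong[OF _ that]) (simp add: k(2))
        then have "\<forall>e\<in>edges \<Sigma>. delta \<Sigma> \<omega> 0 (\<lambda>v. p v - q v) e = 0"
          using k(1) by simp
        moreover from this have "\<forall>e\<in>edges \<Sigma>. delta \<Sigma> \<omega> u p e = delta \<Sigma> \<omega> u q e"
          unfolding delta_diff[of \<Sigma> \<omega> u p _ q, symmetric] by simp
        ultimately have "?F p = f" "\<forall>e\<in>edges \<Sigma>. delta \<Sigma> \<omega> u p e \<noteq> 0"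
          using delta_iff q(1) by simp_all
        moreover have "p \<in> verts \<Sigma> \<rightarrow>\<^sub>E UNIV"
          unfolding k(2) by simp
        ultimately show "p \<in> {p \<in> ?P. ?F p = f}"
          by blast
      qed
    qed
    then show ?thesis
      by (rule bij_betw_same_card)
  qed
  have "card ?P = (\<Sum>f\<in>?F ` ?P. card {p \<in> ?P. ?F p = f})"
    using sum.group[OF fin finite_imageI[OF fin, of ?F] subset_refl, of "\<lambda>_. 1::nat"]
    unfolding card_eq_sum by (rule sym)
  also have "\<dots> = (\<Sum>f\<in>?F ` ?P. card ?K)"
    by (intro sum.cong refl fibre)
  also have "\<dots> = card (?F ` ?P) * card ?K"
    by (simp only: sum_constant of_nat_id)
  finally show ?thesis
    unfolding nz_tensions_coset_eq by (rule sym)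
qed

text \<open>Treats doubles and non-doubles together: \<open>z\<close> is the proportion of group
  elements \<open>x\<close> with \<open>x + x = - u\<close>. Multiplying by the kernel size
  \<open>K\<close> turns the count into an inclusion-exclusion sum, which is compared term by
  term.\<close>

lemma card_nz_tensions_coset_tutte:
  fixes u :: "'g::{ab_group_add, finite}" and z :: real
  assumes z: "real (card {x::'g. x + x = - u}) = real CARD('g) * z"
  shows "real (card (nz_tensions_coset \<Sigma> \<omega> u)) =
    (-1) ^ graph_rank \<Sigma> * real (card (doubles :: 'g set)) ^ num_unbal_comps \<Sigma> *
    signed_tutte \<Sigma> (1 - real CARD('g)) 0 (1 - z)"
proof -
  define n d where "n = real CARD('g)" and "d = real (card (doubles :: 'g set))"
  have pos: "n > 0" "d > 0"
    using card_doubles_pos[where 'g = 'g] by (simp_all add: n_def d_def)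
  have nd: "real (card {x::'g. x + x = 0}) = n / d"
    by (simp add: n_def d_def card_two_torsion)
  define K where "K = n ^ num_bal_comps \<Sigma> * (n / d) ^ num_unbal_comps \<Sigma>"
  have "spanning_subgraph \<Sigma> (edges \<Sigma>) = \<Sigma>"
    by (simp add: spanning_subgraph_def)
  then have K: "real (card {k \<in> verts \<Sigma> \<rightarrow>\<^sub>E UNIV. \<forall>e\<in>edges \<Sigma>. delta \<Sigma> \<omega> (0::'g) k e = 0}) = K"
    using card_delta_zero_on[OF subset_refl, of "0::'g"] nd by (simp add: K_def n_def)
  have "K > 0"
    using pos by (simp add: K_def)
  have "real (card (nz_tensions_coset \<Sigma> \<omega> u)) * K =
      real (card {p \<in> verts \<Sigma> \<rightarrow>\<^sub>E UNIV. \<forall>e\<in>edges \<Sigma>. \<not> delta \<Sigma> \<omega> u p e = 0})"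
    using arg_cong[OF card_nz_tensions_coset[of u], of real] by (simp add: K)
  also have "\<dots> = (\<Sum>A\<in>Pow (edges \<Sigma>). (-1) ^ card A *
      real (card {p \<in> verts \<Sigma> \<rightarrow>\<^sub>E UNIV. \<forall>e\<in>A. delta \<Sigma> \<omega> u p e = 0}))"
    by (intro inclusion_exclusion_avoiding finite_edges finite_PiE finite_verts) simp
  also have "\<dots> = (\<Sum>A\<in>Pow (edges \<Sigma>).
      (-1) ^ graph_rank \<Sigma> * d ^ num_unbal_comps \<Sigma> *
      ((1 - n - 1) powi (int (num_comps (spanning_subgraph \<Sigma> A)) - int (num_comps \<Sigma>)) *
       (0 - 1) powi (int (card A) - int (card (verts \<Sigma>)) + int (num_bal_comps (spanning_subgraph \<Sigma> A))) *
       (1 - z - 1) ^ num_unbal_comps (spanning_subgraph \<Sigma> A)) * K)"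
  proof (intro sum.cong refl)
    fix A assume "A \<in> Pow (edges \<Sigma>)"
    then have A: "A \<subseteq> edges \<Sigma>"
      by simp
    interpret A: finite_signed_graph "spanning_subgraph \<Sigma> A"
      using finite_signed_graph_spanning[OF _ A] finite_signed_graph_axioms by blast
    \<comment> \<open>Stated for variables so that \<open>num_comps_eq\<close> instantiates them
      with the two component counts.\<close>
    have "b + c \<le> card (verts \<Sigma>)" if "num_comps \<Sigma> = b + c" for b c
      using num_comps_le that by simp
    note eq = tutte_term_eq[OF pos this[OF num_comps_eq], of
        "num_bal_comps (spanning_subgraph \<Sigma> A)" "num_unbal_comps (spanning_subgraph \<Sigma> A)" "card A" z,
        folded num_comps_eq A.num_comps_eq K_def]
    show "(-1) ^ card A * real (card {p \<in> verts \<Sigma> \<rightarrow>\<^sub>E UNIV. \<forall>e\<in>A. delta \<Sigma> \<omega> u p e = 0}) =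
      (-1) ^ graph_rank \<Sigma> * d ^ num_unbal_comps \<Sigma> *
      ((1 - n - 1) powi (int (num_comps (spanning_subgraph \<Sigma> A)) - int (num_comps \<Sigma>)) *
       (0 - 1) powi (int (card A) - int (card (verts \<Sigma>)) + int (num_bal_comps (spanning_subgraph \<Sigma> A))) *
       (1 - z - 1) ^ num_unbal_comps (spanning_subgraph \<Sigma> A)) * K"
      using eq card_delta_zero_on[OF A, of u] z by (simp add: n_def graph_rank_def)
  qed
  also have "\<dots> = ((-1) ^ graph_rank \<Sigma> * d ^ num_unbal_comps \<Sigma> * signed_tutte \<Sigma> (1 - n) 0 (1 - z)) * K"
    by (simp only: signed_tutte_def sum_distrib_left sum_distrib_right)
  finally show ?thesis
    using \<open>K > 0\<close> by (simp add: n_def d_def)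
qed

lemma card_nz_tensions_coset_double:
  fixes u :: "'g::{ab_group_add, finite}"
  assumes "u \<in> doubles"
  shows "real (card (nz_tensions_coset \<Sigma> \<omega> u)) =
    (-1) ^ graph_rank \<Sigma> * real (card (doubles :: 'g set)) ^ num_unbal_comps \<Sigma> *
    signed_tutte \<Sigma> (1 - real CARD('g)) 0 (1 - 1 / real (card (doubles :: 'g set)))"
proof (rule card_nz_tensions_coset_tutte)
  have "card {x::'g. x + x = - u} = card {x::'g. x + x = 0}"
    using card_double_fibre doubles_uminus[OF assms] by blast
  then show "real (card {x::'g. x + x = - u}) = real CARD('g) * (1 / real (card (doubles :: 'g set)))"
    by (simp add: card_two_torsion)
qed

text \<open>No \<open>x\<close> satisfies \<open>x + x = - u\<close>, so this is the case
  \<open>z = 0\<close>.\<close>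

lemma card_nz_tensions_coset_not_double:
  fixes u :: "'g::{ab_group_add, finite}"
  assumes "u \<notin> doubles"
  shows "real (card (nz_tensions_coset \<Sigma> \<omega> u)) =
    (-1) ^ graph_rank \<Sigma> * real (card (doubles :: 'g set)) ^ num_unbal_comps \<Sigma> *
    signed_tutte \<Sigma> (1 - real CARD('g)) 0 1"
proof -
  have "{x::'g. x + x = - u} = {}"
  proof (intro equals0I, clarify)
    fix x assume "x + x = - u"
    then have "- u \<in> doubles"
      using doubles_double[of x] by simp
    then show False
      using assms doubles_uminus[of "- u"] by simp
  qed
  then show ?thesis
    using card_nz_tensions_coset_tutte[of u 0] by simp
qed

lemma nz_potential_differences_eq:
  "nz_potential_differences \<Sigma> \<omega> = nz_tensions_coset \<Sigma> \<omega> 0"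
  by (auto simp: nz_potential_differences_def nz_tensions_coset_def nz_tensions_def
      potential_difference_def)

section \<open>All tensions of a connected unbalanced graph\<close>

lemma unbalanced_cycle_walk_ex:
  assumes "\<not> balanced \<Sigma>"
  obtains W where "unbalanced_cycle_walk \<Sigma> W"
proof -
  obtain C where "unbalanced_cycle \<Sigma> C"
    using assms by (auto simp: balanced_def balanced_cycle_def unbalanced_cycle_def)
  moreover from this obtain W where "closed_walk \<Sigma> W" "distinct (edge_list W)" "set (edge_list W) = C"
    by (auto simp: unbalanced_cycle_def cycle_def)
  ultimately show thesis
    using that by (auto simp: unbalanced_cycle_walk_def)
qed

lemma connected_walk:
  assumes "connected_graph \<Sigma>" "a \<in> verts \<Sigma>" "b \<in> verts \<Sigma>"
  obtains W where "walk \<Sigma> a W b"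
proof -
  obtain U where "components \<Sigma> = {U}"
    using assms(1) by (auto simp: connected_graph_def num_comps_def card_1_singleton_iff)
  then have "component_of a = component_of b"
    using assms(2,3) unfolding components_eq by blast
  then have "b \<in> component_of a"
    using component_of_self[OF assms(3)] by simp
  then show thesis
    using that by (auto simp: component_of_def)
qed

text \<open>A walk from the root to an unbalanced cycle, around it and back is a negative closed
  walk in the only component.\<close>

lemma connected_unbalanced_num_unbal_comps:
  assumes "connected_graph \<Sigma>" "\<not> balanced \<Sigma>"
  shows "num_unbal_comps \<Sigma> = 1"
proof -
  obtain U where U: "components \<Sigma> = {U}"
    using assms(1) by (auto simp: connected_graph_def num_comps_def card_1_singleton_iff)
  obtain W where W: "unbalanced_cycle_walk \<Sigma> W"
    using unbalanced_cycle_walk_ex[OF assms(2)] .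
  then obtain v where v: "walk \<Sigma> v W v"
    by (auto simp: unbalanced_cycle_walk_def closed_walk_def)
  obtain Q where Q: "walk \<Sigma> (comp_root U) Q v"
    by (rule connected_walk[OF assms(1) component_of_root(1) walk_verts(1)[OF v]]) (simp add: U)
  have "walk \<Sigma> (comp_root U) (Q @ W @ rev_walk Q) (comp_root U)"
    unfolding walk_append using Q v walk_rev[OF Q] by blast
  moreover have "walk_sign \<Sigma> (Q @ W @ rev_walk Q) = -1"
    using unbalanced_cycle_walk_sign[OF W] walk_sign_cases[OF Q] by auto
  ultimately have "\<not> balanced (induced_subgraph \<Sigma> U)"
    using balanced_component_iff[of U] U by (auto simp del: walk_append walk_sign_simps)
  then have "{V \<in> components \<Sigma>. \<not> balanced (induced_subgraph \<Sigma> V)} = {U}"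
    using U by auto
  then show ?thesis
    by (simp add: num_unbal_comps_def)
qed

text \<open>Join the two cycles by a walk \<open>Q\<close>. The closed walk
  \<open>V @ Q @ W @ rev_walk Q\<close> is positive, so \<open>V\<close> has the same sum as a
  conjugate of \<open>W\<close>.\<close>

lemma connected_tension_coset:
  fixes f :: "'e \<Rightarrow> 'g::ab_group_add"
  assumes "connected_graph \<Sigma>" "tension \<Sigma> \<omega> f"
    and "unbalanced_cycle_walk \<Sigma> V" "unbalanced_cycle_walk \<Sigma> W"
  shows "walk_sum \<Sigma> \<omega> f W - walk_sum \<Sigma> \<omega> f V \<in> doubles"
proof -
  let ?S = "walk_sum \<Sigma> \<omega> f"
  obtain a b where a: "walk \<Sigma> a V a" and b: "walk \<Sigma> b W b"
    using assms(3,4) by (auto simp: unbalanced_cycle_walk_def closed_walk_def)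
  obtain Q where Q: "walk \<Sigma> a Q b"
    using connected_walk[OF assms(1) walk_verts(1)[OF a] walk_verts(1)[OF b]] .
  have s: "walk_sign \<Sigma> V = -1" "walk_sign \<Sigma> W = -1"
    using assms(3,4) unbalanced_cycle_walk_sign by blast+
  have "walk \<Sigma> a (V @ Q @ W @ rev_walk Q) a"
    unfolding walk_append using a b Q walk_rev[OF Q] by blast
  moreover have "walk_sign \<Sigma> (V @ Q @ W @ rev_walk Q) = 1"
    using s walk_sign_cases[OF Q] by auto
  ultimately have "?S (V @ Q @ W @ rev_walk Q) = 0"
    using tension_positive_closed_walk[OF assms(2)] by blast
  then have "?S V = ?S (Q @ W @ rev_walk Q)"
    using s(1) by (simp add: walk_sum_append[OF a])
  then show ?thesis
    using doubles_uminus[OF walk_sum_conjugate[OF Q b s(2), of f]] by simp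
qed

text \<open>Double counting of pairs of a tension and an element \<open>u\<close>: each tension lies
  in the set for \<open>u\<close> exactly when \<open>u\<close> is congruent modulo doubles to its
  sum around one fixed unbalanced cycle.\<close>

lemma card_nz_tensions:
  assumes "connected_graph \<Sigma>" "\<not> balanced \<Sigma>"
  shows "card (nz_tensions \<Sigma> \<omega> :: ('e \<Rightarrow> 'g::{ab_group_add, finite}) set) * card (doubles :: 'g set) =
    (\<Sum>u\<in>(UNIV :: 'g set). card (nz_tensions_coset \<Sigma> \<omega> u))"
proof -
  let ?T = "nz_tensions \<Sigma> \<omega> :: ('e \<Rightarrow> 'g) set"
  obtain V where V: "unbalanced_cycle_walk \<Sigma> V"
    using unbalanced_cycle_walk_ex[OF assms(2)] .
  have fin: "finite ?T"
    by (rule finite_subset[of _ "edges \<Sigma> \<rightarrow>\<^sub>E UNIV"])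
      (auto simp: nz_tensions_def intro: finite_PiE finite_edges)
  have coset: "card {u. f \<in> nz_tensions_coset \<Sigma> \<omega> u} = card (doubles :: 'g set)" if f: "f \<in> ?T" for f
  proof -
    have "f \<in> nz_tensions_coset \<Sigma> \<omega> u \<longleftrightarrow> walk_sum \<Sigma> \<omega> f V - u \<in> doubles" for u
    proof
      assume "walk_sum \<Sigma> \<omega> f V - u \<in> doubles"
      moreover have "walk_sum \<Sigma> \<omega> f W - walk_sum \<Sigma> \<omega> f V \<in> doubles" if "unbalanced_cycle_walk \<Sigma> W" for W
        using connected_tension_coset[of f, OF assms(1) _ V that] f by (simp add: nz_tensions_def)
      ultimately have "walk_sum \<Sigma> \<omega> f W - u \<in> doubles" if "unbalanced_cycle_walk \<Sigma> W" for W
        using that doubles_add[of "walk_sum \<Sigma> \<omega> f W - walk_sum \<Sigma> \<omega> f V" "walk_sum \<Sigma> \<omega> f V - u"] by simp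
      then show "f \<in> nz_tensions_coset \<Sigma> \<omega> u"
        using f unfolding nz_tensions_coset_def walk_sum_mod_doubles_coset by blast
    qed (use V in \<open>auto simp: nz_tensions_coset_def walk_sum_mod_doubles_coset\<close>)
    moreover have "bij_betw (\<lambda>u. walk_sum \<Sigma> \<omega> f V - u) {u. walk_sum \<Sigma> \<omega> f V - u \<in> doubles} doubles"
      by (rule bij_betw_byWitness[where f' = "\<lambda>x. walk_sum \<Sigma> \<omega> f V - x"]) auto
    ultimately show ?thesis
      using bij_betw_same_card by auto
  qed
  have "card ?T * card (doubles :: 'g set) = (\<Sum>f\<in>?T. \<Sum>u\<in>UNIV. if f \<in> nz_tensions_coset \<Sigma> \<omega> u then 1 else 0)"
    using coset by (simp add: sum.If_cases Int_def)
  also have "\<dots> = (\<Sum>u\<in>(UNIV :: 'g set). \<Sum>f\<in>?T. if f \<in> nz_tensions_coset \<Sigma> \<omega> u then 1 else 0)"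
    by (rule sum.swap)
  also have "\<dots> = (\<Sum>u\<in>(UNIV :: 'g set). card (nz_tensions_coset \<Sigma> \<omega> u))"
  proof (intro sum.cong refl)
    fix u :: 'g
    have "?T \<inter> {f. f \<in> nz_tensions_coset \<Sigma> \<omega> u} = nz_tensions_coset \<Sigma> \<omega> u"
      by (auto simp: nz_tensions_coset_def)
    then show "(\<Sum>f\<in>?T. if f \<in> nz_tensions_coset \<Sigma> \<omega> u then 1 else 0) = card (nz_tensions_coset \<Sigma> \<omega> u)"
      using fin by (simp add: sum.If_cases)
  qed
  finally show ?thesis .
qed

end

section \<open>Evaluations of the signed Tutte polynomial\<close>

theorem theorem7p10:
  fixes \<Sigma> :: "('v, 'e) signed_graph" and \<omega> :: "'e \<times> bool \<Rightarrow> int"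
  assumes "signed_graph \<Sigma>" and "compatible_orientation \<Sigma> \<omega>"
  shows
    "real (card (nz_potential_differences \<Sigma> \<omega> :: ('e \<Rightarrow> 'g::{ab_group_add, finite}) set)) =
       (-1) ^ graph_rank \<Sigma> * real (card (doubles :: 'g set)) ^ num_unbal_comps \<Sigma> *
       signed_tutte \<Sigma> (1 - real CARD('g)) 0 (1 - 1 / real (card (doubles :: 'g set)))
     \<and>
     (\<forall>u::'g. u \<notin> doubles \<longrightarrow>
        real (card (nz_tensions_coset \<Sigma> \<omega> u)) =
          (-1) ^ graph_rank \<Sigma> * real (card (doubles :: 'g set)) ^ num_unbal_comps \<Sigma> *
          signed_tutte \<Sigma> (1 - real CARD('g)) 0 1)
     \<and>
     (connected_graph \<Sigma> \<and> \<not> balanced \<Sigma> \<longrightarrow>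
        real (card (nz_tensions \<Sigma> \<omega> :: ('e \<Rightarrow> 'g) set)) =
          (-1) ^ graph_rank \<Sigma> * real (card (doubles :: 'g set)) *
          (signed_tutte \<Sigma> (1 - real CARD('g)) 0 (1 - 1 / real (card (doubles :: 'g set)))
           + (real CARD('g) / real (card (doubles :: 'g set)) - 1) *
             signed_tutte \<Sigma> (1 - real CARD('g)) 0 1))"
proof -
  interpret oriented_signed_graph \<Sigma> \<omega>
    using assms by unfold_locales
  define d n where "d = real (card (doubles :: 'g set))" and "n = real CARD('g)"
  define s t0 t1 where "s = (-1 :: real) ^ graph_rank \<Sigma>"
    and "t0 = signed_tutte \<Sigma> (1 - n) 0 (1 - 1 / d)" and "t1 = signed_tutte \<Sigma> (1 - n) 0 1"
  note defs = d_def n_def s_def t0_def t1_def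
  have potential: "real (card (nz_potential_differences \<Sigma> \<omega> :: ('e \<Rightarrow> 'g) set)) =
      s * d ^ num_unbal_comps \<Sigma> * t0"
    using card_nz_tensions_coset_double[OF doubles_0, where 'g = 'g]
    by (simp add: nz_potential_differences_eq defs)
  have "real (card (nz_tensions \<Sigma> \<omega> :: ('e \<Rightarrow> 'g) set)) = s * d * (t0 + (n / d - 1) * t1)"
    if conn: "connected_graph \<Sigma>" "\<not> balanced \<Sigma>"
  proof -
    have "d > 0"
      using card_doubles_pos[where 'g = 'g] by (simp add: d_def)
    have ku: "num_unbal_comps \<Sigma> = 1"
      using connected_unbalanced_num_unbal_comps conn by blast
    have "real (card (nz_tensions \<Sigma> \<omega> :: ('e \<Rightarrow> 'g) set)) * d =
        (\<Sum>u\<in>(UNIV :: 'g set). real (card (nz_tensions_coset \<Sigma> \<omega> u)))"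
      using arg_cong[OF card_nz_tensions[OF conn, where 'g = 'g], of real] by (simp add: d_def)
    \<comment> \<open>The count depends only on whether \<open>u\<close> is a double, and the power
      of \<open>d\<close> is 1 as there is one unbalanced component.\<close>
    also have "\<dots> = (\<Sum>u\<in>(UNIV :: 'g set). if u \<in> doubles then s * d * t0 else s * d * t1)"
      using ku by (intro sum.cong refl)
        (simp add: card_nz_tensions_coset_double card_nz_tensions_coset_not_double defs)
    also have "\<dots> = d * (s * d * t0) + (n - d) * (s * d * t1)"
    proof -
      have "card (- (doubles :: 'g set)) = CARD('g) - card (doubles :: 'g set)"
        by (simp add: Compl_eq_Diff_UNIV card_Diff_subset)
      then have "real (card (- (doubles :: 'g set))) = n - d"
        using card_mono[of UNIV "doubles :: 'g set"] by (simp add: n_def d_def of_nat_diff)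
      then show ?thesis
        by (simp add: sum.If_cases d_def Compl_eq)
    qed
    also have "\<dots> = s * d * (t0 + (n / d - 1) * t1) * d"
      using \<open>d > 0\<close> by (simp add: field_simps)
    finally show ?thesis
      using \<open>d > 0\<close> by simp
  qed
  then show ?thesis
    using potential card_nz_tensions_coset_not_double[where 'g = 'g] by (simp add: defs)
qed

end
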